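(* Let $(\Sigma,\sigma)$ be a topologically mixing countable Markov shift and let the potential $\mathcal{F}=\{f_n\}_{n=1}^{\infty}$ on $\Sigma$ be almost-additive and summable with bounded variation. For $t>1$ let $\mu_{t\mathcal{F}}$ be the (unique) equilibrium state for $t\mathcal{F}$, and let $\mu_\infty\in\mathcal{M}$ be an accumulation point of the family $(\mu_{t\mathcal{F}})_{t>1}$ as $t\to\infty$. Then $$\lim_{t\to\infty}\mathcal{F}_*(\mu_{t\mathcal{F}})=\mathcal{F}_*(\mu_\infty)=\sup\{\mathcal{F}_*(\nu):\nu\in\mathcal{M}\}.$$ As a consequence, $\mu_\infty$ is a maximising measure for $\mathcal{F}$.
   Context: Countable Markov shift: the alphabet is $\mathcal{A}=\mathbb{N}=\{1,2,\dots\}$, $\mathbf{M}=(M_{ij})_{\mathcal{A}\times\mathcal{A}}$ is a matrix of zeros and ones with no zero row and no zero column, $\Sigma=\{x=x_1x_2\cdots\in\mathcal{A}^{\mathbb{N}}: M_{x_ix_{i+1}}=1\ \forall i\in\mathbb{N}\}$, and $\sigma:\Sigma\to\Sigma$ is the shift $(\sigma(x))_i=x_{i+1}$. $\Sigma$ has the topology generated by the cylinders $[w]=\{x\in\Sigma: x_1\cdots x_n=w\}$, $w$ an admissible word of length $n$ (i.e. $M_{w_iw_{i+1}}=1$ for $1\le i<n$). $(\Sigma,\sigma)$ is topologically mixing if for all $a,b\in\mathcal{A}$ there is $N_{ab}\in\mathbb{N}$ such that for every $n\ge N_{ab}$ there is an admissible word $w_1\cdots w_n$ with $w_1=a$, $w_n=b$.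 Potentials: $\mathcal{F}=\{f_n\}_{n=1}^\infty$ is a sequence of continuous functions $f_n:\Sigma\to\mathbb{R}$; $t\mathcal{F}=\{tf_n\}_{n=1}^\infty$. It is almost-additive if there is $C\ge 0$ with $f_n(x)+f_m(\sigma^n x)-C\le f_{n+m}(x)\le f_n(x)+f_m(\sigma^n x)+C$ for all $n,m\in\mathbb{N}$, $x\in\Sigma$. It has bounded variation if there is $C\ge0$ with $\sup_n\sup\{|f_n(x)-f_n(y)|: x,y\in\Sigma,\ x_i=y_i,\ 1\le i\le n\}\le C$. It is summable if $\sum_{i\in\mathbb{N}}\exp(\sup (f_1|_{[i]}))<\infty$. $\mathcal{M}$ is the set of $\sigma$-invariant Borel probability measures on $\Sigma$, with the weak (weak-star) topology, i.e. convergence against bounded continuous functions. $h(\mu)$ is the Kolmogorov–Sinai entropy of $\mu\in\mathcal{M}$, and $\mathcal{F}_*(\mu)=\lim_{n\to\infty}\frac1n\int f_n\,d\mu\in[-\infty,\infty)$. A measure $\mu\in\mathcal{M}$ is maximising for $\mathcal{F}$ if $\mathcal{F}_*(\mu)=\sup\{\mathcal{F}_*(\nu):\nu\in\mathcal{M}\}$. Gurevich pressure: $P_G(\mathcal{F})=\lim_{n\to\infty}\frac1n\log\big(\sum_{\sigma^nx=x}\exp(f_n(x))\chi_{[a]}(x)\big)$, which is independent of $a\in\mathcal{A}$. An equilibrium state for $t\mathcal{F}$ is a measure $\mu\in\mathcal{M}$ with $P_G(t\mathcal{F})=h(\mu)+t\mathcal{F}_*(\mu)$ (in particular $\mathcal{F}_*(\mu)>-\infty$).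 Under the stated hypotheses there is exactly one equilibrium state $\mu_{t\mathcal{F}}$ for each $t>1$, and the family $(\mu_{t\mathcal{F}})_{t>1}$ has an accumulation point as $t\to\infty$, i.e. a measure $\mu_\infty\in\mathcal{M}$ such that $\mu_{t_k\mathcal{F}}\to\mu_\infty$ weakly for some sequence $t_k\to\infty$. *)

theory Defs
  imports "HOL-Probability.Probability"
begin

text \<open>
  The alphabet \<open>\<nat> = {1, 2, \<dots>}\<close> is relabelled as the type \<^typ>\<open>nat\<close>, and the coordinates
  \<open>x\<^sub>1, x\<^sub>2, \<dots>\<close> of a sequence are \<open>x 0, x 1, \<dots>\<close>.
\<close>

definition transition_matrix :: "(nat \<Rightarrow> nat \<Rightarrow> nat) \<Rightarrow> bool" where
  "transition_matrix M \<longleftrightarrow>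
     (\<forall>i j. M i j \<in> {0, 1}) \<and> (\<forall>i. \<exists>j. M i j = 1) \<and> (\<forall>j. \<exists>i. M i j = 1)"

definition shift_space :: "(nat \<Rightarrow> nat \<Rightarrow> nat) \<Rightarrow> (nat \<Rightarrow> nat) set" where
  "shift_space M = {x. \<forall>i. M (x i) (x (Suc i)) = 1}"

definition shift :: "(nat \<Rightarrow> nat) \<Rightarrow> (nat \<Rightarrow> nat)" where
  "shift x = (\<lambda>i. x (Suc i))"

definition admissible :: "(nat \<Rightarrow> nat \<Rightarrow> nat) \<Rightarrow> nat list \<Rightarrow> bool" where
  "admissible M w \<longleftrightarrow> w \<noteq> [] \<and> (\<forall>i. Suc i < length w \<longrightarrow> M (w ! i) (w ! Suc i) = 1)"

definition cylinder :: "(nat \<Rightarrow> nat \<Rightarrow> nat) \<Rightarrow> nat list \<Rightarrow> (nat \<Rightarrow> nat) set" where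
  "cylinder M w = {x \<in> shift_space M. \<forall>i<length w. x i = w ! i}"

definition shift_topology :: "(nat \<Rightarrow> nat \<Rightarrow> nat) \<Rightarrow> (nat \<Rightarrow> nat) topology" where
  "shift_topology M = topology_generated_by (cylinder M ` {w. admissible M w})"

lemma topspace_shift_topology [simp]: "topspace (shift_topology M) = shift_space M"
proof -
  have "x \<in> cylinder M [x 0]" if "x \<in> shift_space M" for x
    using that by (simp add: cylinder_def)
  moreover have "admissible M [a]" for a
    by (simp add: admissible_def)
  ultimately show ?thesis
    unfolding shift_topology_def topology_generated_by_topspace
    by (fastforce simp: cylinder_def)
qed

definition topologically_mixing :: "(nat \<Rightarrow> nat \<Rightarrow> nat) \<Rightarrow> bool" where
  "topologically_mixing M \<longleftrightarrow>
     (\<forall>a b. \<exists>N\<ge>1. \<forall>n\<ge>N. \<exists>w. admissible M w \<and> length w = n \<and> hd w = a \<and> last w = b)"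

text \<open>
  A potential is a family \<open>f n\<close>, of which only the members with \<open>n \<ge> 1\<close> and only their values on
  the shift space matter.
\<close>

type_synonym potential = "nat \<Rightarrow> (nat \<Rightarrow> nat) \<Rightarrow> real"

definition continuous_potential :: "(nat \<Rightarrow> nat \<Rightarrow> nat) \<Rightarrow> potential \<Rightarrow> bool" where
  "continuous_potential M f \<longleftrightarrow>
     (\<forall>n\<ge>1. continuous_map (shift_topology M) euclideanreal (f n))"

definition scale_potential :: "real \<Rightarrow> potential \<Rightarrow> potential" where
  "scale_potential t f = (\<lambda>n x. t * f n x)"

definition almost_additive :: "(nat \<Rightarrow> nat \<Rightarrow> nat) \<Rightarrow> potential \<Rightarrow> bool" where
  "almost_additive M f \<longleftrightarrow>
     (\<exists>C\<ge>0. \<forall>n\<ge>1. \<forall>m\<ge>1. \<forall>x\<in>shift_space M.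
        f n x + f m ((shift ^^ n) x) - C \<le> f (n + m) x \<and>
        f (n + m) x \<le> f n x + f m ((shift ^^ n) x) + C)"

definition bounded_variation :: "(nat \<Rightarrow> nat \<Rightarrow> nat) \<Rightarrow> potential \<Rightarrow> bool" where
  "bounded_variation M f \<longleftrightarrow>
     (\<exists>C\<ge>0. \<forall>n\<ge>1. \<forall>x\<in>shift_space M. \<forall>y\<in>shift_space M.
        (\<forall>i<n. x i = y i) \<longrightarrow> \<bar>f n x - f n y\<bar> \<le> C)"

text \<open>
  Boundedness above is part of the definition because an infinite supremum makes the series
  diverge, whereas \<^const>\<open>Sup\<close> on the reals is unspecified for unbounded sets.
\<close>

definition summable_potential :: "(nat \<Rightarrow> nat \<Rightarrow> nat) \<Rightarrow> potential \<Rightarrow> bool" where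
  "summable_potential M f \<longleftrightarrow>
     (\<forall>i. bdd_above (f 1 ` cylinder M [i])) \<and>
     summable (\<lambda>i. exp (SUP x\<in>cylinder M [i]. f 1 x))"

definition shift_borel :: "(nat \<Rightarrow> nat \<Rightarrow> nat) \<Rightarrow> (nat \<Rightarrow> nat) measure" where
  "shift_borel M = sigma (shift_space M) {U. openin (shift_topology M) U}"

definition invariant_measures :: "(nat \<Rightarrow> nat \<Rightarrow> nat) \<Rightarrow> (nat \<Rightarrow> nat) measure set" where
  "invariant_measures M =
     {\<mu>. sets \<mu> = sets (shift_borel M) \<and> prob_space \<mu> \<and>
         (\<forall>A\<in>sets \<mu>. emeasure \<mu> (shift -` A \<inter> space \<mu>) = emeasure \<mu> A)}"

definition weakly_converges ::
  "(nat \<Rightarrow> nat \<Rightarrow> nat) \<Rightarrow> (nat \<Rightarrow> (nat \<Rightarrow> nat) measure) \<Rightarrow> (nat \<Rightarrow> nat) measure \<Rightarrow> bool" where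
  "weakly_converges M \<mu> \<nu> \<longleftrightarrow>
     (\<forall>g. continuous_map (shift_topology M) euclideanreal g \<and> bounded (g ` shift_space M) \<longrightarrow>
          (\<lambda>k. integral\<^sup>L (\<mu> k) g) \<longlonglongrightarrow> integral\<^sup>L \<nu> g)"

definition accumulation_point_at_top ::
  "(nat \<Rightarrow> nat \<Rightarrow> nat) \<Rightarrow> (real \<Rightarrow> (nat \<Rightarrow> nat) measure) \<Rightarrow> (nat \<Rightarrow> nat) measure \<Rightarrow> bool" where
  "accumulation_point_at_top M \<mu> \<nu> \<longleftrightarrow>
     \<nu> \<in> invariant_measures M \<and>
     (\<exists>t :: nat \<Rightarrow> real. (\<forall>k. t k > 1) \<and> filterlim t at_top sequentially \<and>
        weakly_converges M (\<lambda>k. \<mu> (t k)) \<nu>)"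

text \<open>
  Kolmogorov--Sinai entropy of a measure-preserving map: the supremum over finite measurable
  partitions \<open>P\<close> of the entropy rates, where \<open>iterated_join \<mu> T P n\<close> is the join of the partitions
  \<open>T\<^sup>-\<^sup>i P\<close> for \<open>i < n\<close>.
\<close>

definition finite_measurable_partitions :: "'a measure \<Rightarrow> 'a set set set" where
  "finite_measurable_partitions \<mu> = {P. finite P \<and> P \<subseteq> sets \<mu> \<and> partition_on (space \<mu>) P}"

definition partition_entropy :: "'a measure \<Rightarrow> 'a set set \<Rightarrow> real" where
  "partition_entropy \<mu> P = - (\<Sum>A\<in>P. measure \<mu> A * ln (measure \<mu> A))"

definition iterated_join ::
  "'a measure \<Rightarrow> ('a \<Rightarrow> 'a) \<Rightarrow> 'a set set \<Rightarrow> nat \<Rightarrow> 'a set set" where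
  "iterated_join \<mu> T P n =
     {B. B \<noteq> {} \<and> (\<exists>s. (\<forall>i<n. s i \<in> P) \<and> B = {x \<in> space \<mu>. \<forall>i<n. (T ^^ i) x \<in> s i})}"

definition entropy_rate :: "'a measure \<Rightarrow> ('a \<Rightarrow> 'a) \<Rightarrow> 'a set set \<Rightarrow> ereal" where
  "entropy_rate \<mu> T P = lim (\<lambda>n. ereal (partition_entropy \<mu> (iterated_join \<mu> T P n) / real n))"

definition KS_entropy :: "'a measure \<Rightarrow> ('a \<Rightarrow> 'a) \<Rightarrow> ereal" where
  "KS_entropy \<mu> T = (SUP P\<in>finite_measurable_partitions \<mu>. entropy_rate \<mu> T P)"

text \<open>
  Integral with values in the extended reals, for functions whose positive part has finite
  integral. For summable almost-additive potentials every \<open>f n\<close> is bounded above, but its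
  integral may be \<open>-\<infinity>\<close>, which the Bochner integral does not express.
\<close>

definition ext_integral :: "'a measure \<Rightarrow> ('a \<Rightarrow> real) \<Rightarrow> ereal" where
  "ext_integral \<mu> g =
     enn2ereal (\<integral>\<^sup>+x. ennreal (g x) \<partial>\<mu>) - enn2ereal (\<integral>\<^sup>+x. ennreal (- g x) \<partial>\<mu>)"

definition mean_potential :: "potential \<Rightarrow> (nat \<Rightarrow> nat) measure \<Rightarrow> ereal" where
  "mean_potential f \<mu> = lim (\<lambda>n. ereal (1 / real n) * ext_integral \<mu> (f n))"

definition maximising_measure ::
  "(nat \<Rightarrow> nat \<Rightarrow> nat) \<Rightarrow> potential \<Rightarrow> (nat \<Rightarrow> nat) measure \<Rightarrow> bool" where
  "maximising_measure M f \<mu> \<longleftrightarrow>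
     \<mu> \<in> invariant_measures M \<and>
     mean_potential f \<mu> = (SUP \<nu>\<in>invariant_measures M. mean_potential f \<nu>)"

definition ext_ln :: "ennreal \<Rightarrow> ereal" where
  "ext_ln x = (if x = 0 then - \<infinity> else if x = \<top> then \<infinity> else ereal (ln (enn2real x)))"

definition periodic_sum ::
  "(nat \<Rightarrow> nat \<Rightarrow> nat) \<Rightarrow> potential \<Rightarrow> nat \<Rightarrow> nat \<Rightarrow> ennreal" where
  "periodic_sum M f a n =
     (\<Sum>\<^sub>\<infinity>x\<in>{x \<in> shift_space M. (shift ^^ n) x = x}.
        ennreal (exp (f n x) * indicator (cylinder M [a]) x))"

text \<open>The description operator picks the limit that is common to all letters \<open>a\<close>.\<close>

definition gurevich_pressure :: "(nat \<Rightarrow> nat \<Rightarrow> nat) \<Rightarrow> potential \<Rightarrow> ereal" where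
  "gurevich_pressure M f =
     (THE p. \<forall>a. (\<lambda>n. ereal (1 / real n) * ext_ln (periodic_sum M f a n)) \<longlonglongrightarrow> p)"

text \<open>
  An equilibrium state for \<open>t \<F>\<close>. The finiteness condition keeps the extended-real sum from
  being \<open>\<infinity> - \<infinity>\<close>.
\<close>

definition equilibrium_state ::
  "(nat \<Rightarrow> nat \<Rightarrow> nat) \<Rightarrow> potential \<Rightarrow> real \<Rightarrow> (nat \<Rightarrow> nat) measure \<Rightarrow> bool" where
  "equilibrium_state M f t \<mu> \<longleftrightarrow>
     \<mu> \<in> invariant_measures M \<and> mean_potential f \<mu> > - \<infinity> \<and>
     gurevich_pressure M (scale_potential t f) =
       KS_entropy \<mu> shift + ereal t * mean_potential f \<mu>"

end

theory Submission
  imports Defs "HOL-Real_Asymp.Real_Asymp"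
begin

text \<open>
  Write \<open>A \<nu>\<close> for the mean of the potential and \<open>P t\<close> for the Gurevich pressure of \<open>t \<F>\<close>. Only a
  weak form of the variational principle is needed.

  Lower bound: \<open>t * A \<nu> \<le> P t\<close> for every invariant \<open>\<nu>\<close>. For a finite set \<open>B\<close> of letters of
  measure close to 1, most points \<open>x\<close> have both \<open>x 0\<close> and \<open>x n\<close> in \<open>B\<close>, so by averaging some such
  point satisfies \<open>f n x \<ge> n * (A \<nu> - \<epsilon>) - const\<close>; by mixing its orbit segment closes up to a periodic
  orbit at a cost independent of \<open>n\<close>.

  Upper bound: \<open>h \<nu> \<le> K - A \<nu>\<close> with \<open>K\<close> independent of \<open>\<nu>\<close>. To encode the itinerary of a
  point with respect to a finite partition, encode its letters with the weights \<open>exp (sup (f 1 | [i]))\<close>,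
  normalised to sum 1, and then the itinerary given the letters. As the partition is
  approximated by cylinder sets, the second step costs at most \<open>ln 2 + 1\<close> per symbol; Gibbs' inequality
  turns the code length into an entropy bound.

  For equilibrium states \<open>\<mu> t\<close> this gives \<open>t * A \<nu> \<le> K + (t - 1) * A (\<mu> t)\<close>, so \<open>A (\<mu> t)\<close> tends to the
  supremum. Subadditivity bounds \<open>A\<close> above by integrals of continuous functions that are bounded
  above, hence \<open>A\<close> is upper semicontinuous and the supremum is attained at the accumulation point.
\<close>

section \<open>Subadditive sequences and Gibbs' inequality\<close>

text \<open>On a countable alphabet the shift space need not be compact, the partition into letters
  is infinite, the \<open>f n\<close> may be unbounded below, and finiteness of the entropy is not
  known beforehand. The estimates are therefore arranged so that errors need only be bounded, not
  small: the constant in the entropy bound is divided by \<open>t\<close> in the end, so its size is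
  harmless as long as it is the same for all measures.

  Uniformity rests on one fact: if \<open>f 1\<close> is integrable, the integral of
  \<open>f n\<close> differs from \<open>n * A \<nu>\<close> by at most the almost-additivity
  constant, for every \<open>n\<close> and every invariant measure. A mean can thus be compared with
  the integral of one fixed \<open>f n\<close>, which replaces an exchange of limits both in the
  entropy bound (at \<open>n = 1\<close>) and in upper semicontinuity.

  Entropy is handled through code lengths instead of conditional entropies. One form of Gibbs'
  inequality yields both the subadditivity of the entropies of iterated joins, needed for the
  entropy rate to be a genuine limit, and the coding bound itself.\<close>

lemma fekete:
  fixes a :: "nat \<Rightarrow> real"
  assumes N: "1 \<le> N"
    and sub: "\<And>n m. N \<le> n \<Longrightarrow> N \<le> m \<Longrightarrow> a (n + m) \<le> a n + a m"
  shows "(\<lambda>n. ereal (a n / real n)) \<longlonglongrightarrow> (INF n\<in>{N..}. ereal (a n / real n))"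
proof -
  have mult: "a (q * n + r) \<le> real q * a n + a r" if "N \<le> n" "N \<le> r" for q n r
  proof (induction q)
    case (Suc q)
    have "a (n + (q * n + r)) \<le> a n + a (q * n + r)"
      using that by (intro sub) auto
    then show ?case
      using Suc by (simp add: algebra_simps)
  qed simp
  \<comment> \<open>Subadditivity is assumed only from \<open>N\<close> on, because later it is
    applied to logarithms of sums that may vanish for small indices. The limit is taken in
    \<open>ereal\<close> since the infimum may be minus infinity.\<close>
  have upper: "limsup (\<lambda>m. ereal (a m / real m)) \<le> ereal (a n / real n)" if n: "N \<le> n" for n
  proof -
    have n0: "0 < n" using n N by simp
    \<comment> \<open>Division of \<open>m\<close> by \<open>n\<close> leaves only finitely many
      remainders, so their total effect is one constant, which disappears after dividing by
      \<open>m\<close>.\<close>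
    define K where "K = Max ((\<lambda>r. a r - real r * a n / real n) ` {N..<N + n})"
    have bound: "a m / real m \<le> a n / real n + K / real m" if m: "N \<le> m" for m
    proof -
      define q where "q = (m - N) div n"
      \<comment> \<open>The remainder is taken in the window from \<open>N\<close> to
        \<open>N + n\<close> rather than below \<open>n\<close>, so that subadditivity may be
        applied to it.\<close>
      define r where "r = N + (m - N) mod n"
      have mqr: "m = q * n + r"
        using m by (simp add: q_def r_def)
      have "r \<in> {N..<N + n}"
        using n0 by (simp add: r_def)
      then have K: "a r - real r * a n / real n \<le> K"
        unfolding K_def by (intro Max_ge) auto
      have "a m \<le> real q * a n + a r"
        unfolding mqr by (rule mult) (use n in \<open>auto simp: r_def\<close>)
      moreover have "real m * (a n / real n) = real q * a n + real r * a n / real n"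
        using n0 by (simp add: mqr field_simps)
      ultimately have "a m \<le> real m * (a n / real n) + K"
        using K by linarith
      moreover have "real m > 0" using m N by simp
      ultimately show ?thesis
        by (simp add: field_simps)
    qed
    have "(\<lambda>m. ereal (a n / real n + K / real m)) \<longlonglongrightarrow> ereal (a n / real n + 0)"
      by (intro tendsto_intros lim_const_over_n)
    then have "limsup (\<lambda>m. ereal (a n / real n + K / real m)) = ereal (a n / real n)"
      by (intro lim_imp_Limsup) auto
    moreover have "limsup (\<lambda>m. ereal (a m / real m)) \<le> limsup (\<lambda>m. ereal (a n / real n + K / real m))"
      by (rule Limsup_mono, rule eventually_sequentiallyI[of N]) (use bound in auto)
    ultimately show ?thesis by simp
  qed
  have "limsup (\<lambda>m. ereal (a m / real m)) \<le> (INF n\<in>{N..}. ereal (a n / real n))"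
    by (intro INF_greatest upper) auto
  moreover have "(INF n\<in>{N..}. ereal (a n / real n)) \<le> liminf (\<lambda>m. ereal (a m / real m))"
    by (intro Liminf_bounded eventually_sequentiallyI[of N] INF_lower) auto
  ultimately show ?thesis
    by (subst tendsto_iff_Liminf_eq_Limsup)
       (use Liminf_le_Limsup[of sequentially "\<lambda>m. ereal (a m / real m)"] in auto)
qed

section \<open>Gibbs' inequality for finite partitions\<close>

context prob_space
begin

lemma sum_prob_partition:
  assumes "P \<in> finite_measurable_partitions M"
  shows "(\<Sum>A\<in>P. prob A) = 1"
  by (subst finite_measure_finite_Union[symmetric])
     (use assms in \<open>auto simp: finite_measurable_partitions_def partition_on_def
         disjoint_family_on_def disjoint_def prob_space\<close>)

text \<open>Gibbs' inequality with \<open>G\<close> as code length and \<open>q\<close> as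
  subprobability vector. The link between them is required only on average over each atom: on a null
  atom the convention \<open>ln 0 = 0\<close> can make the code length of a point meaningless, and a
  pointwise bound would fail there.\<close>

lemma partition_entropy_le:
  assumes P: "P \<in> finite_measurable_partitions M"
    and G: "integrable M G"
    and q: "\<And>A. A \<in> P \<Longrightarrow> (\<integral>\<^sup>+x\<in>A. ennreal (exp (- G x)) \<partial>M) \<le> ennreal (prob A * q A)"
    and q0: "\<And>A. A \<in> P \<Longrightarrow> 0 \<le> q A" and q1: "(\<Sum>A\<in>P. q A) \<le> 1"
  shows "partition_entropy M P \<le> (\<integral>x. G x \<partial>M)"
proof -
  have finP: "finite P" and setsP: "\<And>A. A \<in> P \<Longrightarrow> A \<in> sets M" and part: "partition_on (space M) P"
    using P by (auto simp: finite_measurable_partitions_def)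
  have "prob A \<le> q A + (\<integral>x. indicator A x * G x \<partial>M) + prob A * ln (prob A)" if A: "A \<in> P" for A
  proof (cases "prob A = 0")
    case True
    \<comment> \<open>A null atom contributes nothing to the integral, and
      \<open>0 * ln 0 = 0\<close>, so only \<open>0 \<le> q A\<close> remains.\<close>
    then have "AE x in M. x \<notin> A"
      using A setsP by (intro AE_not_in) (auto simp: null_sets_def emeasure_eq_measure)
    then have "(\<integral>x. indicator A x * G x \<partial>M) = (\<integral>x. 0 \<partial>M)"
      by (intro integral_cong_AE) (use G A setsP in auto)
    then show ?thesis using True q0[OF A] by simp
  next
    case False
    let ?b = "prob A"
    have b: "0 < ?b" using False by (simp add: measure_le_0_iff order.strict_iff_order)
    have [measurable]: "A \<in> sets M" "G \<in> borel_measurable M" using A setsP G by auto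
    have eq: "(\<integral>\<^sup>+x. ennreal (indicator A x * exp (- G x)) \<partial>M) \<le> ennreal (?b * q A)"
      using q[OF A] by (simp add: ennreal_mult'' ennreal_indicator mult.commute)
    have int: "integrable M (\<lambda>x. indicator A x * exp (- G x))"
      by (rule integrableI_bounded) (use eq in \<open>auto simp: abs_mult intro: order.strict_trans1\<close>)
    have le: "(\<integral>x. indicator A x * exp (- G x) \<partial>M) \<le> ?b * q A"
      using eq q0[OF A] by (subst (asm) nn_integral_eq_integral[OF int]) auto
    have intG: "integrable M (\<lambda>x. indicator A x * G x)"
      using integrable_mult_indicator[OF \<open>A \<in> sets M\<close> G] by simp
    have intA: "integrable M (indicator A :: _ \<Rightarrow> real)" by (simp add: emeasure_eq_measure)
    have "(\<integral>x. indicator A x * (- (G x)) \<partial>M)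
        \<le> (\<integral>x. (ln ?b - 1) * indicator A x + (indicator A x * exp (- G x)) / ?b \<partial>M)"
    proof (rule integral_mono)
      fix x assume "x \<in> space M"
      \<comment> \<open>The inequality \<open>ln y \<le> y - 1\<close> at
        \<open>y = exp (- G x) / prob A\<close>; integrated over the atom, its right-hand side is at
        most \<open>q A - prob A\<close>.\<close>
      have "- G x - ln ?b = ln (exp (- G x) / ?b)"
        using b by (simp add: ln_div)
      also have "\<dots> \<le> exp (- G x) / ?b - 1"
        using b by (intro ln_le_minus_one) auto
      finally show "indicator A x * (- (G x))
          \<le> (ln ?b - 1) * indicator A x + (indicator A x * exp (- G x)) / ?b"
        by (auto simp: indicator_def)
    qed (use intG intA int in auto)
    also have "\<dots> = (ln ?b - 1) * ?b + (\<integral>x. indicator A x * exp (- G x) \<partial>M) / ?b"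
      using intA int by simp
    also have "\<dots> \<le> (ln ?b - 1) * ?b + q A"
      using le b by (simp add: field_simps)
    finally show ?thesis
      by (simp add: algebra_simps)
  qed
  then have "(\<Sum>A\<in>P. prob A) \<le> (\<Sum>A\<in>P. q A + (\<integral>x. indicator A x * G x \<partial>M) + prob A * ln (prob A))"
    by (rule sum_mono)
  also have "\<dots> = (\<Sum>A\<in>P. q A) + (\<Sum>A\<in>P. \<integral>x. indicator A x * G x \<partial>M) - partition_entropy M P"
    by (simp add: sum.distrib partition_entropy_def)
  also have "(\<Sum>A\<in>P. \<integral>x. indicator A x * G x \<partial>M) = (\<integral>x. (\<Sum>A\<in>P. indicator A x * G x) \<partial>M)"
    using integrable_mult_indicator[OF setsP G] by (intro Bochner_Integration.integral_sum[symmetric]) auto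
  also have "\<dots> = (\<integral>x. G x \<partial>M)"
  proof (rule Bochner_Integration.integral_cong[OF refl])
    fix x assume "x \<in> space M"
    then obtain A where A: "A \<in> P" "x \<in> A" using part by (auto simp: partition_on_def)
    then have "(\<Sum>B\<in>P. indicator B x * G x) = (\<Sum>B\<in>P. if B = A then G x else 0)"
      using part by (intro sum.cong) (auto simp: partition_on_def disjoint_def indicator_def)
    then show "(\<Sum>B\<in>P. indicator B x * G x) = G x" using A finP by simp
  qed
  also have "(\<Sum>A\<in>P. prob A) = 1"
    by (rule sum_prob_partition[OF P])
  finally show ?thesis using q1 by linarith
qed

lemma partition_entropy_le_pointwise:
  assumes P: "P \<in> finite_measurable_partitions M" and G: "integrable M G"
    and q: "\<And>A x. A \<in> P \<Longrightarrow> x \<in> A \<Longrightarrow> exp (- G x) \<le> q A"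
    and q0: "\<And>A. A \<in> P \<Longrightarrow> 0 \<le> q A" and q1: "(\<Sum>A\<in>P. q A) \<le> 1"
  shows "partition_entropy M P \<le> (\<integral>x. G x \<partial>M)"
proof (rule partition_entropy_le[OF P G _ q0 q1])
  fix A assume A: "A \<in> P"
  then have As: "A \<in> sets M" using P by (auto simp: finite_measurable_partitions_def)
  have "(\<integral>\<^sup>+x\<in>A. ennreal (exp (- G x)) \<partial>M) \<le> (\<integral>\<^sup>+x. ennreal (q A) * indicator A x \<partial>M)"
    using q[OF A] by (intro nn_integral_mono) (auto simp: indicator_def intro!: ennreal_leI)
  also have "\<dots> = ennreal (prob A * q A)"
    using As q0[OF A] by (subst nn_integral_cmult_indicator) (auto simp: emeasure_eq_measure ennreal_mult ac_simps)
  finally show "(\<integral>\<^sup>+x\<in>A. ennreal (exp (- G x)) \<partial>M) \<le> ennreal (prob A * q A)" .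
qed

end

section \<open>Entropy rates of measure-preserving maps\<close>

locale measure_preserving_map = prob_space +
  fixes T :: "'a \<Rightarrow> 'a"
  assumes T [measurable]: "T \<in> measurable M M"
    and invariant: "\<And>A. A \<in> sets M \<Longrightarrow> emeasure M (T -` A \<inter> space M) = emeasure M A"
begin

lemma funpow_measurable [measurable]: "(T ^^ n) \<in> measurable M M"
  using T by (induction n) (auto intro: measurable_comp simp: id_def)

lemma funpow_in_space: "x \<in> space M \<Longrightarrow> (T ^^ n) x \<in> space M"
  by (rule measurable_space[OF funpow_measurable])

lemma distr_funpow: "distr M M (T ^^ n) = M"
proof (induction n)
  case (Suc n)
  have "distr M M T = M"
    by (rule measure_eqI) (auto simp: emeasure_distr invariant)
  then have "distr M M (T ^^ n \<circ> T) = distr M M (T ^^ n)"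
    using distr_distr[of "T ^^ n" M M T M] by simp
  then show ?case
    using Suc by (simp only: funpow_Suc_right)
qed (simp add: id_def distr_id)

lemma prob_funpow:
  assumes "A \<in> sets M" shows "prob ((T ^^ n) -` A \<inter> space M) = prob A"
  using measure_distr[OF funpow_measurable assms, of n] by (simp add: distr_funpow)

lemma integral_funpow:
  fixes g :: "'a \<Rightarrow> real" assumes "g \<in> borel_measurable M"
  shows "(\<integral>x. g ((T ^^ n) x) \<partial>M) = (\<integral>x. g x \<partial>M)"
  using integral_distr[OF funpow_measurable assms, of n] by (simp add: distr_funpow)

lemma integrable_funpow:
  fixes g :: "'a \<Rightarrow> real" assumes "integrable M g"
  shows "integrable M (\<lambda>x. g ((T ^^ n) x))"
  using integrable_distr[OF funpow_measurable, of n g] assms by (simp add: distr_funpow)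

lemma integral_sum_funpow:
  fixes g :: "'a \<Rightarrow> real"
  assumes "integrable M g"
  shows "integrable M (\<lambda>x. \<Sum>i<n. g ((T ^^ i) x))"
    and "(\<integral>x. (\<Sum>i<n. g ((T ^^ i) x)) \<partial>M) = real n * (\<integral>x. g x \<partial>M)"
  using integrable_funpow[OF assms] integral_funpow[OF borel_measurable_integrable[OF assms]]
  by (simp_all add: Bochner_Integration.integral_sum)

lemma iterated_joinI:
  assumes "\<And>i. i < n \<Longrightarrow> s i \<in> P" "{x \<in> space M. \<forall>i<n. (T ^^ i) x \<in> s i} \<noteq> {}"
  shows "{x \<in> space M. \<forall>i<n. (T ^^ i) x \<in> s i} \<in> iterated_join M T P n"
  unfolding iterated_join_def using assms by (intro CollectI conjI exI[of _ s]) auto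

lemma iterated_join_partition:
  assumes P: "P \<in> finite_measurable_partitions M"
  shows "iterated_join M T P n \<in> finite_measurable_partitions M"
proof -
  have finP: "finite P" and setsP: "\<And>A. A \<in> P \<Longrightarrow> A \<in> sets M" and part: "partition_on (space M) P"
    using P by (auto simp: finite_measurable_partitions_def)
  let ?J = "iterated_join M T P n"
  let ?B = "\<lambda>s. {x \<in> space M. \<forall>i<n. (T ^^ i) x \<in> s i}"
  have "?J \<subseteq> ?B ` ({..<n} \<rightarrow>\<^sub>E P)"
  proof
    fix B assume "B \<in> ?J"
    then obtain s where s: "\<forall>i<n. s i \<in> P" "B = ?B s"
      by (auto simp: iterated_join_def)
    \<comment> \<open>Only the values of an itinerary below \<open>n\<close> matter; restricting it
      leaves finitely many candidates.\<close>
    have "B = ?B (restrict s {..<n})" using s by auto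
    moreover have "restrict s {..<n} \<in> {..<n} \<rightarrow>\<^sub>E P" using s by auto
    ultimately show "B \<in> ?B ` ({..<n} \<rightarrow>\<^sub>E P)" by blast
  qed
  then have "finite ?J"
    by (rule finite_subset) (use finP in \<open>auto intro!: finite_PiE\<close>)
  moreover have "?J \<subseteq> sets M"
  proof
    fix B assume "B \<in> ?J"
    then obtain s where s: "\<forall>i<n. s i \<in> P" "B = ?B s"
      by (auto simp: iterated_join_def)
    have "B = space M \<inter> (\<Inter>i\<in>{..<n}. (T ^^ i) -` s i \<inter> space M) \<or> n = 0 \<and> B = space M"
      using s by auto
    moreover have "space M \<inter> (\<Inter>i\<in>{..<n}. (T ^^ i) -` s i \<inter> space M) \<in> sets M" if "n \<noteq> 0"
      using s setsP that by (intro sets.Int sets.finite_INT measurable_sets[OF funpow_measurable]) auto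
    ultimately show "B \<in> sets M" by (cases "n = 0") auto
  qed
  moreover have "partition_on (space M) ?J"
  proof (rule partition_onI)
    show "\<Union>?J = space M"
    proof
      show "space M \<subseteq> \<Union>?J"
      proof
        fix x assume x: "x \<in> space M"
        have "\<exists>A\<in>P. (T ^^ i) x \<in> A" for i
          using funpow_in_space[OF x, of i] part by (auto simp: partition_on_def)
        then obtain s where s: "\<And>i. s i \<in> P" "\<And>i. (T ^^ i) x \<in> s i" by metis
        then have "x \<in> ?B s" using x by auto
        then have "?B s \<in> ?J" using s by (intro iterated_joinI) blast+
        then show "x \<in> \<Union>?J" using \<open>x \<in> ?B s\<close> by blast
      qed
    qed (auto simp: iterated_join_def)
  next
    fix B B' assume B: "B \<in> ?J" "B' \<in> ?J" "B \<noteq> B'"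
    then obtain s s' where s: "\<forall>i<n. s i \<in> P" "B = ?B s" "\<forall>i<n. s' i \<in> P" "B' = ?B s'"
      by (auto simp: iterated_join_def)
    show "disjnt B B'"
    proof (rule ccontr)
      assume "\<not> disjnt B B'"
      then obtain x where x: "x \<in> B" "x \<in> B'" by (auto simp: disjnt_def)
      have "s i = s' i" if i: "i < n" for i
        using x s i part unfolding partition_on_def disjoint_def by blast
      then show False using s B by auto
    qed
  qed (auto simp: iterated_join_def)
  ultimately show ?thesis by (simp add: finite_measurable_partitions_def)
qed

text \<open>Each atom of the long join is an atom of length \<open>n\<close> met with the preimage
  of one of length \<open>m\<close>. Coding it by the two informations separately corresponds to the
  product weights \<open>?q\<close>, and invariance turns the mean code length into the sum of the
  two entropies.\<close>

lemma partition_entropy_iterated_join_add: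
  assumes P: "P \<in> finite_measurable_partitions M"
  shows "partition_entropy M (iterated_join M T P (n + m))
    \<le> partition_entropy M (iterated_join M T P n) + partition_entropy M (iterated_join M T P m)"
proof -
  let ?J = "iterated_join M T P"
  \<comment> \<open>The information function of the join: exactly one summand has a nonzero
    indicator at a given point, and the form as a finite sum makes its integral immediate.\<close>
  let ?g = "\<lambda>k x. \<Sum>A\<in>?J k. indicator A x * (- ln (prob A))"
  have J: "?J k \<in> finite_measurable_partitions M" for k
    by (rule iterated_join_partition[OF P])
  have fin: "finite (?J k)" and sets: "A \<in> ?J k \<Longrightarrow> A \<in> sets M"
    and part: "partition_on (space M) (?J k)" for k A
    using J[of k] by (auto simp: finite_measurable_partitions_def)
  have "\<exists>A A'. A \<in> ?J n \<and> A' \<in> ?J m \<and> B = A \<inter> ((T ^^ n) -` A' \<inter> space M)" if B: "B \<in> ?J (n + m)" for B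
  proof -
    obtain s where s: "\<forall>i<n+m. s i \<in> P" "B = {x \<in> space M. \<forall>i<n+m. (T ^^ i) x \<in> s i}" "B \<noteq> {}"
      using B by (auto simp: iterated_join_def)
    let ?A = "{x \<in> space M. \<forall>i<n. (T ^^ i) x \<in> s i}"
    let ?A' = "{x \<in> space M. \<forall>i<m. (T ^^ i) x \<in> s (n + i)}"
    have shift_idx: "(T ^^ i) ((T ^^ n) x) = (T ^^ (n + i)) x" for i x
      by (simp add: funpow_add add.commute)
    have eq: "B = ?A \<inter> ((T ^^ n) -` ?A' \<inter> space M)"
    proof (intro set_eqI iffI)
      fix x assume "x \<in> ?A \<inter> ((T ^^ n) -` ?A' \<inter> space M)"
      then have x: "x \<in> space M" "\<And>i. i < n \<Longrightarrow> (T ^^ i) x \<in> s i" "\<And>i. i < m \<Longrightarrow> (T ^^ (n+i)) x \<in> s (n+i)"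
        by (auto simp: shift_idx)
      have "(T ^^ i) x \<in> s i" if "i < n + m" for i
        using x(2)[of i] x(3)[of "i - n"] that by (cases "i < n") auto
      then show "x \<in> B" using x s by auto
    qed (auto simp: s(2) shift_idx funpow_in_space)
    with s(3) have "?A \<noteq> {}" "?A' \<noteq> {}" by auto
    then have "?A \<in> ?J n" "?A' \<in> ?J m"
      using s(1) by (auto intro!: iterated_joinI)
    with eq show ?thesis by blast
  qed
  then obtain a b where ab: "\<And>B. B \<in> ?J (n + m) \<Longrightarrow> a B \<in> ?J n \<and> b B \<in> ?J m \<and>
      B = a B \<inter> ((T ^^ n) -` b B \<inter> space M)" by metis
  have g_eq: "?g k x = - ln (prob A)" if "A \<in> ?J k" "x \<in> A" for k A x
  proof -
    have "?g k x = (\<Sum>B\<in>?J k. if B = A then - ln (prob A) else 0)"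
      using part[of k] that by (intro sum.cong) (auto simp: partition_on_def disjoint_def indicator_def)
    then show ?thesis using that fin by simp
  qed
  have int: "integrable M (?g k)" for k
    using sets by (intro Bochner_Integration.integrable_sum integrable_mult_left) (auto simp: emeasure_eq_measure)
  have val: "(\<integral>x. ?g k x \<partial>M) = partition_entropy M (?J k)" for k
    using sets by (subst Bochner_Integration.integral_sum) (auto simp: partition_entropy_def emeasure_eq_measure sum_negf)
  let ?q = "\<lambda>B. prob (a B) * prob (b B)"
  have "partition_entropy M (?J (n + m)) \<le> (\<integral>x. ?g n x + ?g m ((T ^^ n) x) \<partial>M)"
  proof (rule partition_entropy_le[where q = ?q])
    fix B assume B: "B \<in> ?J (n + m)"
    note abB = ab[OF B]
    have Bs: "B \<in> sets M" using sets B by blast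
    have le1: "prob B \<le> prob (a B)"
      using abB sets by (intro finite_measure_mono) auto
    have "prob B \<le> prob ((T ^^ n) -` b B \<inter> space M)"
      using abB sets by (intro finite_measure_mono) auto
    then have le2: "prob B \<le> prob (b B)"
      using prob_funpow[of "b B" n] sets[OF conjunct1[OF conjunct2[OF abB]]] by simp
    show "(\<integral>\<^sup>+x\<in>B. ennreal (exp (- (?g n x + ?g m ((T ^^ n) x)))) \<partial>M) \<le> ennreal (prob B * ?q B)"
    \<comment> \<open>For a null \<open>B\<close> a factor of \<open>?q B\<close> may be 0 while the
      corresponding information is \<open>- ln 0 = 0\<close>; the bound then holds only in its
      integrated form.\<close>
    proof (cases "prob B = 0")
      case True
      then have "AE x in M. x \<notin> B"
        using Bs by (intro AE_not_in) (auto simp: null_sets_def emeasure_eq_measure)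
      then have "(\<integral>\<^sup>+x\<in>B. ennreal (exp (- (?g n x + ?g m ((T ^^ n) x)))) \<partial>M) = (\<integral>\<^sup>+x. 0 \<partial>M)"
        by (intro nn_integral_cong_AE) auto
      then show ?thesis by simp
    next
      case False
      then have pos: "0 < prob (a B)" "0 < prob (b B)"
        using le1 le2 measure_nonneg[of M B] by linarith+
      have "exp (- (?g n x + ?g m ((T ^^ n) x))) = ?q B" if "x \<in> B" for x
      proof -
        have "x \<in> a B" "(T ^^ n) x \<in> b B" using that abB by auto
        then have "?g n x = - ln (prob (a B))" "?g m ((T ^^ n) x) = - ln (prob (b B))"
          using g_eq abB by blast+
        then show ?thesis using pos by (simp add: exp_add)
      qed
      then have "(\<integral>\<^sup>+x\<in>B. ennreal (exp (- (?g n x + ?g m ((T ^^ n) x)))) \<partial>M)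
          = (\<integral>\<^sup>+x. ennreal (?q B) * indicator B x \<partial>M)"
        by (intro nn_integral_cong) (auto simp: indicator_def)
      also have "\<dots> = ennreal (prob B * ?q B)"
        using Bs by (subst nn_integral_cmult_indicator) (auto simp: emeasure_eq_measure ennreal_mult ac_simps)
      finally show ?thesis by simp
    qed
  next
    \<comment> \<open>An atom is recovered from its two parts, so the weights are part of a product
      distribution and sum to at most 1.\<close>
    have "inj_on (\<lambda>B. (a B, b B)) (?J (n + m))"
      by (rule inj_onI) (metis ab prod.inject)
    then have "(\<Sum>B\<in>?J (n + m). ?q B) = (\<Sum>(A, A')\<in>(\<lambda>B. (a B, b B)) ` ?J (n + m). prob A * prob A')"
      by (simp add: sum.reindex)
    also have "\<dots> \<le> (\<Sum>(A, A')\<in>?J n \<times> ?J m. prob A * prob A')"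
      using ab fin by (intro sum_mono2) auto
    also have "\<dots> = 1"
      by (simp add: sum.cartesian_product[symmetric] sum_product[symmetric] sum_prob_partition[OF J])
    finally show "(\<Sum>B\<in>?J (n + m). ?q B) \<le> 1" .
  qed (use J int integrable_funpow[OF int] in auto)
  also have "\<dots> = partition_entropy M (?J n) + partition_entropy M (?J m)"
    by (simp only: Bochner_Integration.integral_add[OF int integrable_funpow[OF int]]
        integral_funpow[OF borel_measurable_integrable[OF int]] val)
  finally show ?thesis .
qed

text \<open>\<open>entropy_rate\<close> is defined by \<open>lim\<close>, which says nothing until
  convergence is known; subadditivity supplies it.\<close>

lemma entropy_rate_LIMSEQ:
  assumes P: "P \<in> finite_measurable_partitions M"
  shows "(\<lambda>n. ereal (partition_entropy M (iterated_join M T P n) / real n)) \<longlonglongrightarrow> entropy_rate M T P"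
proof -
  have "(\<lambda>n. ereal (partition_entropy M (iterated_join M T P n) / real n))
      \<longlonglongrightarrow> (INF n\<in>{1..}. ereal (partition_entropy M (iterated_join M T P n) / real n))"
    by (rule fekete) (use partition_entropy_iterated_join_add[OF P] in auto)
  then show ?thesis
    unfolding entropy_rate_def using limI by fastforce
qed

end

section \<open>The shift space\<close>

text \<open>Cylinders are exactly the sets fixed by finitely many coordinates, so openness can be
  tested by prefixes. This replaces the generated topology in all later arguments.\<close>

lemma openin_shift_topology:
  "openin (shift_topology M) U \<longleftrightarrow> U \<subseteq> shift_space M \<and>
     (\<forall>x\<in>U. \<exists>m. \<forall>y\<in>shift_space M. (\<forall>i<m. y i = x i) \<longrightarrow> y \<in> U)" (is "_ \<longleftrightarrow> ?R U")
proof
  assume U: "openin (shift_topology M) U"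
  then have sub: "U \<subseteq> shift_space M"
    using openin_subset by fastforce
  have "generate_topology_on (cylinder M ` {w. admissible M w}) U"
    using U by (simp add: shift_topology_def openin_topology_generated_by_iff)
  then have "\<forall>x\<in>U. \<exists>m. \<forall>y\<in>shift_space M. (\<forall>i<m. y i = x i) \<longrightarrow> y \<in> U"
  proof induction
    case (Int A B)
    show ?case
    proof
      fix x assume "x \<in> A \<inter> B"
      with Int obtain m1 m2 where
        "\<forall>y\<in>shift_space M. (\<forall>i<m1. y i = x i) \<longrightarrow> y \<in> A" "\<forall>y\<in>shift_space M. (\<forall>i<m2. y i = x i) \<longrightarrow> y \<in> B"
        by (elim IntE) (drule (1) bspec, drule (1) bspec, auto)
      then show "\<exists>m. \<forall>y\<in>shift_space M. (\<forall>i<m. y i = x i) \<longrightarrow> y \<in> A \<inter> B"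
        by (intro exI[of _ "max m1 m2"]) auto
    qed
  next
    case (UN K)
    show ?case
    proof
      fix x assume "x \<in> \<Union>K"
      then obtain k where k: "k \<in> K" "x \<in> k" by auto
      from bspec[OF UN.IH[OF k(1)] k(2)] obtain m
        where "\<forall>y\<in>shift_space M. (\<forall>i<m. y i = x i) \<longrightarrow> y \<in> k" ..
      with k(1) show "\<exists>m. \<forall>y\<in>shift_space M. (\<forall>i<m. y i = x i) \<longrightarrow> y \<in> \<Union>K"
        by (intro exI[of _ m]) auto
    qed
  next
    case (Basis S)
    then obtain w where "S = cylinder M w" by auto
    then show ?case by (auto simp: cylinder_def intro!: exI[of _ "length w"])
  qed simp
  with sub show "?R U" by (rule conjI)
next
  assume R: "?R U"
  have "\<exists>V. openin (shift_topology M) V \<and> x \<in> V \<and> V \<subseteq> U" if x: "x \<in> U" for x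
  proof -
    have xs: "x \<in> shift_space M" using R x by auto
    from bspec[OF conjunct2[OF R] x]
    obtain m where m: "\<forall>y\<in>shift_space M. (\<forall>i<m. y i = x i) \<longrightarrow> y \<in> U" ..
    \<comment> \<open>One letter more than \<open>m\<close>, because the empty word is not
      admissible.\<close>
    let ?w = "map x [0..<Suc m]"
    have nth: "?w ! i = x i" if "i < Suc m" for i using that by (simp del: upt_Suc)
    have "admissible M ?w"
      using xs by (auto simp: admissible_def shift_space_def nth simp del: upt_Suc)
    then have "openin (shift_topology M) (cylinder M ?w)"
      by (auto simp: shift_topology_def intro!: topology_generated_by_Basis)
    moreover have "x \<in> cylinder M ?w" using xs by (simp add: cylinder_def nth del: upt_Suc)
    moreover have "cylinder M ?w \<subseteq> U"
      using m by (auto simp: cylinder_def nth simp del: upt_Suc)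
    ultimately show ?thesis by blast
  qed
  then show "openin (shift_topology M) U"
    using openin_subopen by blast
qed

lemma openin_shift_topology_subset:
  "openin (shift_topology M) U \<Longrightarrow> x \<in> U \<Longrightarrow> x \<in> shift_space M"
  using openin_subset[of "shift_topology M" U] by auto

lemma shift_in_shift_space: "x \<in> shift_space M \<Longrightarrow> shift x \<in> shift_space M"
  by (simp add: shift_space_def shift_def)

lemma shift_funpow: "(shift ^^ n) x = (\<lambda>i. x (i + n))"
  by (induction n arbitrary: x) (auto simp: shift_def)

lemma funpow_shift_in_shift_space: "x \<in> shift_space M \<Longrightarrow> (shift ^^ n) x \<in> shift_space M"
  by (simp add: shift_space_def shift_funpow)

lemma sets_shift_borel:
  "sets (shift_borel M) = sigma_sets (shift_space M) {U. openin (shift_topology M) U}"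
  unfolding shift_borel_def by (rule sets_measure_of) (auto dest: openin_shift_topology_subset)

lemma space_shift_borel [simp]: "space (shift_borel M) = shift_space M"
  unfolding shift_borel_def by (rule space_measure_of) (auto dest: openin_shift_topology_subset)

lemma openin_sets_shift_borel: "openin (shift_topology M) U \<Longrightarrow> U \<in> sets (shift_borel M)"
  by (auto simp: sets_shift_borel)

lemma measurable_shift_borelI:
  assumes "\<And>x. x \<in> shift_space M \<Longrightarrow> g x \<in> shift_space M"
    and "\<And>U. openin (shift_topology M) U \<Longrightarrow> openin (shift_topology M) {x \<in> shift_space M. g x \<in> U}"
  shows "g \<in> measurable (shift_borel M) (shift_borel M)"
proof (rule measurable_sigma_sets[OF sets_shift_borel])
  show "{U. openin (shift_topology M) U} \<subseteq> Pow (shift_space M)"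
    by (auto dest: openin_shift_topology_subset)
  fix U assume "U \<in> {U. openin (shift_topology M) U}"
  moreover have "g -` U \<inter> space (shift_borel M) = {x \<in> shift_space M. g x \<in> U}" by auto
  ultimately show "g -` U \<inter> space (shift_borel M) \<in> sets (shift_borel M)"
    using assms(2) by (auto intro: openin_sets_shift_borel)
qed (use assms in auto)

lemma shift_measurable: "shift \<in> measurable (shift_borel M) (shift_borel M)"
proof (rule measurable_shift_borelI)
  fix U assume U: "openin (shift_topology M) U"
  show "openin (shift_topology M) {x \<in> shift_space M. shift x \<in> U}"
    unfolding openin_shift_topology
  proof (intro conjI ballI)
    fix x assume "x \<in> {x \<in> shift_space M. shift x \<in> U}"
    then obtain m where m: "\<forall>y\<in>shift_space M. (\<forall>i<m. y i = shift x i) \<longrightarrow> y \<in> U"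
      using U unfolding openin_shift_topology by blast
    have "shift y \<in> U" if "y \<in> shift_space M" "\<forall>i<Suc m. y i = x i" for y
      using m shift_in_shift_space[OF that(1)] that(2) by (auto simp: shift_def)
    then show "\<exists>m. \<forall>y\<in>shift_space M. (\<forall>i<m. y i = x i) \<longrightarrow> y \<in> {x \<in> shift_space M. shift x \<in> U}"
      by (intro exI[of _ "Suc m"]) auto
  qed auto
qed (rule shift_in_shift_space)

lemma continuous_borel_measurable:
  assumes "continuous_map (shift_topology M) euclideanreal g"
  shows "g \<in> borel_measurable (shift_borel M)"
proof (rule borel_measurableI)
  fix S :: "real set" assume "open S"
  then have "openin (shift_topology M) {x \<in> shift_space M. g x \<in> S}"
    using openin_continuous_map_preimage[OF assms, of S] by simp
  moreover have "g -` S \<inter> space (shift_borel M) = {x \<in> shift_space M. g x \<in> S}" by auto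
  ultimately show "g -` S \<inter> space (shift_borel M) \<in> sets (shift_borel M)"
    by (simp add: openin_sets_shift_borel)
qed

section \<open>Functions of finitely many coordinates and approximation of Borel sets\<close>

definition depends_on_prefix :: "(nat \<Rightarrow> nat \<Rightarrow> nat) \<Rightarrow> nat \<Rightarrow> ((nat \<Rightarrow> nat) \<Rightarrow> 'b) \<Rightarrow> bool" where
  "depends_on_prefix M m g \<longleftrightarrow>
     (\<forall>x\<in>shift_space M. \<forall>y\<in>shift_space M. (\<forall>i<m. x i = y i) \<longrightarrow> g x = g y)"

text \<open>All preimages are open, whatever set of values is prescribed. The value type is left
  arbitrary so that predicates, letters and atoms of a partition are covered at once.\<close>

lemma depends_on_prefix_measurable:
  assumes "depends_on_prefix M m g"
  shows "g \<in> measurable (shift_borel M) (count_space UNIV)"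
proof (rule measurableI)
  fix S
  have "openin (shift_topology M) {x \<in> shift_space M. g x \<in> S}"
    unfolding openin_shift_topology
  proof (intro conjI ballI)
    fix x assume "x \<in> {x \<in> shift_space M. g x \<in> S}"
    then show "\<exists>m. \<forall>y\<in>shift_space M. (\<forall>i<m. y i = x i) \<longrightarrow> y \<in> {x \<in> shift_space M. g x \<in> S}"
      using assms unfolding depends_on_prefix_def by (intro exI[of _ m]) (metis (mono_tags, lifting) mem_Collect_eq)
  qed auto
  moreover have "g -` S \<inter> space (shift_borel M) = {x \<in> shift_space M. g x \<in> S}" by auto
  ultimately show "g -` S \<inter> space (shift_borel M) \<in> sets (shift_borel M)"
    by (simp add: openin_sets_shift_borel)
qed simp

locale shift_prob_space = prob_space \<nu> for \<nu> :: "(nat \<Rightarrow> nat) measure" +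
  fixes M :: "nat \<Rightarrow> nat \<Rightarrow> nat"
  assumes sets_eq [measurable_cong]: "sets \<nu> = sets (shift_borel M)"
begin

lemma space_eq: "space \<nu> = shift_space M"
  using sets_eq_imp_space_eq[OF sets_eq] by simp

lemma depends_on_prefix_pred:
  assumes "depends_on_prefix M m g"
  shows "{x \<in> shift_space M. g x \<in> S} \<in> sets \<nu>"
proof -
  have "g -` S \<inter> space (shift_borel M) \<in> sets (shift_borel M)"
    by (rule measurable_sets[OF depends_on_prefix_measurable[OF assms]]) auto
  moreover have "g -` S \<inter> space (shift_borel M) = {x \<in> shift_space M. g x \<in> S}" by auto
  ultimately show ?thesis by (simp add: sets_eq)
qed

text \<open>The sets determined by finitely many coordinates up to arbitrarily small measure. They
  turn out to form a sigma-algebra containing the open sets.\<close>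

definition approximable :: "(nat \<Rightarrow> nat) set \<Rightarrow> bool" where
  "approximable A \<longleftrightarrow> A \<in> sets \<nu> \<and>
     (\<forall>e>0. \<exists>m Q. depends_on_prefix M m Q \<and> prob {x \<in> shift_space M. (x \<in> A) \<noteq> Q x} < e)"

lemma discrepancy_sets:
  assumes "A \<in> sets \<nu>" "depends_on_prefix M m Q"
  shows "{x \<in> shift_space M. (x \<in> A) \<noteq> Q x} \<in> sets \<nu>"
proof -
  have "{x \<in> shift_space M. Q x \<in> {True}} \<in> sets \<nu>"
    by (rule depends_on_prefix_pred[OF assms(2)])
  moreover have "{x \<in> shift_space M. (x \<in> A) \<noteq> Q x} =
     (A - {x \<in> shift_space M. Q x \<in> {True}}) \<union> ({x \<in> shift_space M. Q x \<in> {True}} - A)"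
    using sets.sets_into_space[OF assms(1)] by (auto simp: space_eq)
  ultimately show ?thesis using assms(1) by auto
qed

lemma approximable_open:
  assumes "openin (shift_topology M) U"
  shows "approximable U"
  unfolding approximable_def
proof (intro conjI allI impI)
  have U: "U \<in> sets \<nu>" using openin_sets_shift_borel[OF assms] by (simp add: sets_eq)
  show "U \<in> sets \<nu>" by fact
  fix e :: real assume e: "0 < e"
  \<comment> \<open>\<open>?D m\<close> is the largest event inside \<open>U\<close> that depends on
    \<open>m\<close> coordinates only. These events increase to \<open>U\<close> since
    \<open>U\<close> is open.\<close>
  let ?Q = "\<lambda>m x. \<forall>y\<in>shift_space M. (\<forall>i<m. y i = x i) \<longrightarrow> y \<in> U"
  let ?D = "\<lambda>m. {x \<in> shift_space M. ?Q m x}"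
  have dep: "depends_on_prefix M m (?Q m)" for m
    by (auto simp: depends_on_prefix_def)
  have D: "?D m \<in> sets \<nu>" for m
    using depends_on_prefix_pred[OF dep[of m], of "{True}"] by simp
  have "incseq ?D"
    by (intro incseq_SucI) auto
  then have "(\<lambda>m. prob (?D m)) \<longlonglongrightarrow> prob (\<Union>m. ?D m)"
    using D by (intro finite_Lim_measure_incseq) auto
  moreover have UD: "(\<Union>m. ?D m) = U"
    using assms unfolding openin_shift_topology by blast
  ultimately have "eventually (\<lambda>m. prob (?D m) > prob U - e) sequentially"
    using e by (intro order_tendstoD) auto
  then obtain m where m: "prob (?D m) > prob U - e"
    using eventually_happens by force
  have DU: "?D m \<subseteq> U" using UD by blast
  have "{x \<in> shift_space M. (x \<in> U) \<noteq> ?Q m x} = U - ?D m"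
    using DU assms unfolding openin_shift_topology by blast
  then have "prob {x \<in> shift_space M. (x \<in> U) \<noteq> ?Q m x} = prob U - prob (?D m)"
    using finite_measure_Diff[OF U D DU] by simp
  with m dep show "\<exists>m Q. depends_on_prefix M m Q \<and> prob {x \<in> shift_space M. (x \<in> U) \<noteq> Q x} < e"
    by (intro exI[of _ m] exI[of _ "?Q m"]) auto
qed

lemma approximable_compl:
  assumes "approximable A"
  shows "approximable (shift_space M - A)"
  unfolding approximable_def
proof (intro conjI allI impI)
  show "shift_space M - A \<in> sets \<nu>"
    using assms sets.compl_sets[of A \<nu>] by (auto simp: approximable_def space_eq)
  fix e :: real assume "0 < e"
  then obtain m Q where Q: "depends_on_prefix M m Q" "prob {x \<in> shift_space M. (x \<in> A) \<noteq> Q x} < e"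
    using assms by (auto simp: approximable_def)
  have "{x \<in> shift_space M. (x \<in> shift_space M - A) \<noteq> (\<not> Q x)} = {x \<in> shift_space M. (x \<in> A) \<noteq> Q x}"
    by auto
  moreover have "depends_on_prefix M m (\<lambda>x. \<not> Q x)"
    using Q(1) unfolding depends_on_prefix_def by meson
  ultimately show "\<exists>m Q. depends_on_prefix M m Q \<and> prob {x \<in> shift_space M. (x \<in> shift_space M - A) \<noteq> Q x} < e"
    using Q(2) by (intro exI[of _ m] exI[of _ "\<lambda>x. \<not> Q x"] conjI) simp_all
qed

lemma approximable_Un:
  assumes A: "approximable A" and B: "approximable B"
  shows "approximable (A \<union> B)"
  unfolding approximable_def
proof (intro conjI allI impI)
  show "A \<union> B \<in> sets \<nu>" using A B by (auto simp: approximable_def)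
  fix e :: real assume e: "0 < e"
  obtain m Q where Q: "depends_on_prefix M m Q" "prob {x \<in> shift_space M. (x \<in> A) \<noteq> Q x} < e / 2"
    using A e unfolding approximable_def by (meson half_gt_zero)
  obtain l R where R: "depends_on_prefix M l R" "prob {x \<in> shift_space M. (x \<in> B) \<noteq> R x} < e / 2"
    using B e unfolding approximable_def by (meson half_gt_zero)
  let ?DA = "{x \<in> shift_space M. (x \<in> A) \<noteq> Q x}" and ?DB = "{x \<in> shift_space M. (x \<in> B) \<noteq> R x}"
  have sets: "?DA \<in> sets \<nu>" "?DB \<in> sets \<nu>"
    using A B Q(1) R(1) discrepancy_sets by (auto simp: approximable_def)
  have "prob {x \<in> shift_space M. (x \<in> A \<union> B) \<noteq> (Q x \<or> R x)} \<le> prob (?DA \<union> ?DB)"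
    using sets by (intro finite_measure_mono) auto
  also have "\<dots> \<le> prob ?DA + prob ?DB"
    using sets by (intro measure_Un_le) auto
  finally have "prob {x \<in> shift_space M. (x \<in> A \<union> B) \<noteq> (Q x \<or> R x)} < e"
    using Q R by simp
  moreover have "depends_on_prefix M (max m l) (\<lambda>x. Q x \<or> R x)"
    using Q(1) R(1) unfolding depends_on_prefix_def by (metis max_less_iff_conj less_max_iff_disj)
  ultimately show "\<exists>m Q. depends_on_prefix M m Q \<and> prob {x \<in> shift_space M. (x \<in> A \<union> B) \<noteq> Q x} < e"
    by (intro exI[of _ "max m l"] exI[of _ "\<lambda>x. Q x \<or> R x"]) auto
qed

lemma approximable_UN:
  fixes A :: "nat \<Rightarrow> (nat \<Rightarrow> nat) set"
  assumes A: "\<And>i. approximable (A i)"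
  shows "approximable (\<Union>i. A i)"
  unfolding approximable_def
proof (intro conjI allI impI)
  have As: "A i \<in> sets \<nu>" for i using A[of i] by (simp add: approximable_def)
  then show UA: "(\<Union>i. A i) \<in> sets \<nu>" by auto
  have fin: "approximable (\<Union>i\<le>n. A i)" for n
    by (induction n) (auto simp: atMost_Suc intro!: A approximable_Un)
  fix e :: real assume e: "0 < e"
  have "(\<lambda>n. prob (\<Union>i\<le>n. A i)) \<longlonglongrightarrow> prob (\<Union>n. \<Union>i\<le>n. A i)"
    using As by (intro finite_Lim_measure_incseq) (auto intro!: incseq_SucI simp: atMost_Suc)
  moreover have UU: "(\<Union>n. \<Union>i\<le>n. A i) = (\<Union>i. A i)" by auto
  ultimately have "eventually (\<lambda>n. prob (\<Union>i\<le>n. A i) > prob (\<Union>i. A i) - e / 2) sequentially"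
    using e by (intro order_tendstoD) auto
  then obtain n where n: "prob (\<Union>i\<le>n. A i) > prob (\<Union>i. A i) - e / 2"
    using eventually_happens by force
  obtain m Q where Q: "depends_on_prefix M m Q" "prob {x \<in> shift_space M. (x \<in> (\<Union>i\<le>n. A i)) \<noteq> Q x} < e / 2"
    using fin[of n] e unfolding approximable_def by (meson half_gt_zero)
  let ?D = "{x \<in> shift_space M. (x \<in> (\<Union>i\<le>n. A i)) \<noteq> Q x}"
  have sets: "?D \<in> sets \<nu>" "(\<Union>i\<le>n. A i) \<in> sets \<nu>"
    using discrepancy_sets[OF _ Q(1), of "\<Union>i\<le>n. A i"] fin[of n] by (auto simp: approximable_def)
  have "prob {x \<in> shift_space M. (x \<in> (\<Union>i. A i)) \<noteq> Q x} \<le> prob (?D \<union> ((\<Union>i. A i) - (\<Union>i\<le>n. A i)))"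
    using sets UA by (intro finite_measure_mono) auto
  also have "\<dots> \<le> prob ?D + prob ((\<Union>i. A i) - (\<Union>i\<le>n. A i))"
    using sets UA by (intro measure_Un_le) auto
  also have "prob ((\<Union>i. A i) - (\<Union>i\<le>n. A i)) = prob (\<Union>i. A i) - prob (\<Union>i\<le>n. A i)"
    using sets UA by (intro finite_measure_Diff) auto
  finally show "\<exists>m Q. depends_on_prefix M m Q \<and> prob {x \<in> shift_space M. (x \<in> (\<Union>i. A i)) \<noteq> Q x} < e"
    using Q n by (intro exI[of _ m] exI[of _ Q]) auto
qed

lemma approximable_sets:
  assumes "A \<in> sets \<nu>"
  shows "approximable A"
proof -
  have "A \<in> sigma_sets (shift_space M) {U. openin (shift_topology M) U}"
    using assms by (simp add: sets_eq sets_shift_borel)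
  then show ?thesis
  proof induction
    case Empty
    show ?case by (rule approximable_open) simp
  qed (auto intro: approximable_open approximable_compl approximable_UN)
qed

text \<open>Approximating each atom separately gives predicates that may overlap or miss points;
  they are merged into one function \<open>guess\<close> that reads a finite prefix and names the
  atom wrongly only with small probability.\<close>

lemma approximate_partition:
  assumes P: "P \<in> finite_measurable_partitions \<nu>" and e: "0 < e"
  obtains m guess where "depends_on_prefix M m guess" "\<And>x. guess x \<in> P"
    "{x \<in> shift_space M. x \<notin> guess x} \<in> sets \<nu>" "prob {x \<in> shift_space M. x \<notin> guess x} < e"
proof -
  have finP: "finite P" and setsP: "\<And>A. A \<in> P \<Longrightarrow> A \<in> sets \<nu>" and part: "partition_on (shift_space M) P"
    using P by (auto simp: finite_measurable_partitions_def space_eq)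
  have "P \<noteq> {}" using sum_prob_partition[OF P] by auto
  then have card: "0 < real (card P)" using finP by (simp add: card_gt_0_iff)
  have "\<forall>A\<in>P. \<exists>z. depends_on_prefix M (fst z) (snd z) \<and>
      prob {x \<in> shift_space M. (x \<in> A) \<noteq> snd z x} < e / real (card P)"
  proof
    fix A assume "A \<in> P"
    then have "approximable A" by (intro approximable_sets setsP)
    then obtain m Q where "depends_on_prefix M m Q"
        "prob {x \<in> shift_space M. (x \<in> A) \<noteq> Q x} < e / real (card P)"
      unfolding approximable_def using e card by (meson divide_pos_pos)
    then show "\<exists>z. depends_on_prefix M (fst z) (snd z) \<and>
      prob {x \<in> shift_space M. (x \<in> A) \<noteq> snd z x} < e / real (card P)"
      by (intro exI[of _ "(m, Q)"]) simp
  qed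
  from bchoice[OF this] obtain z where z: "\<forall>A\<in>P. depends_on_prefix M (fst (z A)) (snd (z A)) \<and>
      prob {x \<in> shift_space M. (x \<in> A) \<noteq> snd (z A) x} < e / real (card P)" ..
  define m Q where "m A = fst (z A)" and "Q A = snd (z A)" for A
  have mQ: "depends_on_prefix M (m A) (Q A)"
      "prob {x \<in> shift_space M. (x \<in> A) \<noteq> Q A x} < e / real (card P)" if "A \<in> P" for A
    using bspec[OF z that] by (simp_all add: m_def Q_def)
  let ?m = "Max (m ` P)"
  have le: "m A \<le> ?m" if "A \<in> P" for A using that finP by simp
  define K where "K x = {A \<in> P. Q A x}" for x
  \<comment> \<open>Any atom accepted by its predicate will do, and any atom of \<open>P\<close> if
    none is accepted. The choice depends on \<open>K x\<close> alone, hence on the prefix, and it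
    can only be wrong if some predicate errs at \<open>x\<close>; this is why each predicate gets
    the share \<open>e / real (card P)\<close>.\<close>
  define guess where "guess x = (SOME A. A \<in> (if K x = {} then P else K x))" for x
  have dep: "depends_on_prefix M ?m guess"
    unfolding depends_on_prefix_def
  proof (intro ballI impI)
    fix x y assume xy: "x \<in> shift_space M" "y \<in> shift_space M" "\<forall>i<?m. x i = y i"
    have "Q A x = Q A y" if "A \<in> P" for A
      using mQ(1)[OF that] xy le[OF that] unfolding depends_on_prefix_def by (meson order_less_le_trans)
    then have "K x = K y" by (auto simp: K_def)
    then show "guess x = guess y" by (simp add: guess_def)
  qed
  have guess: "guess x \<in> (if K x = {} then P else K x)" for x
    unfolding guess_def some_in_eq using \<open>P \<noteq> {}\<close> by auto
  have "K x \<subseteq> P" for x by (auto simp: K_def)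
  then have guessP: "guess x \<in> P" for x
    using guess[of x] by (auto split: if_splits)
  have sub: "{x \<in> shift_space M. x \<notin> guess x} \<subseteq> (\<Union>A\<in>P. {x \<in> shift_space M. (x \<in> A) \<noteq> Q A x})"
  proof
    fix x assume x: "x \<in> {x \<in> shift_space M. x \<notin> guess x}"
    show "x \<in> (\<Union>A\<in>P. {x \<in> shift_space M. (x \<in> A) \<noteq> Q A x})"
    proof (rule ccontr)
      assume "\<not> ?thesis"
      then have eq: "\<And>A. A \<in> P \<Longrightarrow> (x \<in> A) = Q A x" using x by auto
      obtain A where "A \<in> P" "x \<in> A" using part x by (auto simp: partition_on_def)
      then have "K x \<noteq> {}" using eq by (auto simp: K_def)
      then have "guess x \<in> K x" using guess[of x] by simp
      then have "guess x \<in> P" "Q (guess x) x" by (simp_all add: K_def)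
      then show False using eq x by auto
    qed
  qed
  have ds: "{x \<in> shift_space M. (x \<in> A) \<noteq> Q A x} \<in> sets \<nu>" if "A \<in> P" for A
    using discrepancy_sets[OF setsP[OF that] mQ(1)[OF that]] .
  have "{x \<in> shift_space M. x \<notin> guess x} = (\<Union>A\<in>P. {x \<in> shift_space M. guess x \<in> {A}} - A)"
    using guessP by auto
  then have s: "{x \<in> shift_space M. x \<notin> guess x} \<in> sets \<nu>"
    using finP setsP depends_on_prefix_pred[OF dep] by (simp only:) (intro sets.finite_UN sets.Diff)
  have "prob {x \<in> shift_space M. x \<notin> guess x} \<le> prob (\<Union>A\<in>P. {x \<in> shift_space M. (x \<in> A) \<noteq> Q A x})"
    using sub ds finP by (intro finite_measure_mono) auto
  also have "\<dots> \<le> (\<Sum>A\<in>P. prob {x \<in> shift_space M. (x \<in> A) \<noteq> Q A x})"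
    using ds finP by (intro finite_measure_subadditive_finite) auto
  also have "\<dots> < (\<Sum>A\<in>P. e / real (card P))"
    using finP \<open>P \<noteq> {}\<close> mQ(2) by (intro sum_strict_mono) auto
  also have "\<dots> = e" using card by simp
  finally show ?thesis using that dep guessP s by blast
qed

end

text \<open>Expanding the power gives the sum over all words. In \<open>ennreal\<close> no
  summability has to be shown; when the total weight is at most 1, the word weights form a
  subprobability vector.\<close>

lemma nn_integral_words:
  fixes p :: "nat \<Rightarrow> ennreal"
  shows "(\<integral>\<^sup>+w. (\<Prod>i<n. p (w ! i)) \<partial>count_space {w. length w = n}) = (\<integral>\<^sup>+i. p i \<partial>count_space UNIV) ^ n"
proof (induction n)
  case 0
  have "{w :: nat list. length w = 0} = {[]}" by auto
  then show ?case by (simp add: nn_integral_count_space_finite)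
next
  case (Suc n)
  let ?W = "\<lambda>n. {w :: nat list. length w = n}"
  let ?S = "\<integral>\<^sup>+i. p i \<partial>count_space UNIV"
  have bij: "bij_betw (\<lambda>(a, w). a # w) (UNIV \<times> ?W n) (?W (Suc n))"
    by (rule bij_betwI[where g = "\<lambda>w. (hd w, tl w)"]) (auto simp: length_Suc_conv)
  have "(\<integral>\<^sup>+w. (\<Prod>i<Suc n. p (w ! i)) \<partial>count_space (?W (Suc n)))
      = (\<integral>\<^sup>+z. (\<Prod>i<Suc n. p ((case z of (a, w) \<Rightarrow> a # w) ! i)) \<partial>count_space (UNIV \<times> ?W n))"
    by (rule nn_integral_bij_count_space[OF bij, symmetric])
  also have "\<dots> = (\<integral>\<^sup>+z. p (fst z) * (\<Prod>i<n. p (snd z ! i)) \<partial>count_space (UNIV \<times> ?W n))"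
    by (intro nn_integral_cong) (auto simp: prod.lessThan_Suc_shift simp del: prod.lessThan_Suc)
  also have "\<dots> = (\<integral>\<^sup>+z. p (fst z) * ((\<Prod>i<n. p (snd z ! i)) * indicator (?W n) (snd z)) \<partial>count_space UNIV)"
    by (subst nn_integral_count_space_indicator) (auto intro!: nn_integral_cong simp: indicator_def)
  also have "\<dots> = (\<integral>\<^sup>+a. \<integral>\<^sup>+w. p a * ((\<Prod>i<n. p (w ! i)) * indicator (?W n) w) \<partial>count_space UNIV \<partial>count_space UNIV)"
    by (subst nn_integral_fst_count_space[symmetric]) simp
  also have "\<dots> = (\<integral>\<^sup>+a. p a * ?S ^ n \<partial>count_space UNIV)"
    by (subst nn_integral_cmult) (auto simp: Suc.IH[symmetric] nn_integral_count_space_indicator[of "?W n"])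
  also have "\<dots> = ?S ^ Suc n"
    by (simp add: nn_integral_multc)
  finally show ?case .
qed

section \<open>An upper bound for the entropy of invariant measures\<close>

locale invariant_shift_measure = shift_prob_space \<nu> M + measure_preserving_map \<nu> shift
  for \<nu> :: "(nat \<Rightarrow> nat) measure" and M
begin

lemma coordinate_measurable: "(\<lambda>x. x i) \<in> measurable \<nu> (count_space UNIV)"
  using depends_on_prefix_measurable[of M "Suc i" "\<lambda>x. x i"]
  by (simp add: depends_on_prefix_def cong: measurable_cong_sets[OF sets_eq refl])

text \<open>A mixture of codes: the word weights \<open>c\<close> come from independent letters with
  weights \<open>exp (s i)\<close>, and given the word, the itinerary has weight \<open>r\<close>.
  Summing over words gives a subprobability vector on the join, so Gibbs' inequality applies with
  the logarithmic weight as code length. The letters number \<open>n + m\<close> because the guess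
  at the last of \<open>n\<close> times still reads \<open>m\<close> letters; the surplus disappears
  in the rate.\<close>

lemma coded_join_entropy_le:
  assumes P: "P \<in> finite_measurable_partitions \<nu>"
    and s: "integrable \<nu> (\<lambda>x. s (x 0))" and s1: "(\<integral>\<^sup>+i. ennreal (exp (s i)) \<partial>count_space UNIV) \<le> 1"
    and dep: "depends_on_prefix M m guess" and guess: "\<And>x. guess x \<in> P"
    and L: "integrable \<nu> (\<lambda>x. if x \<in> guess x then ln 2 else ln (2 * real (card P)))"
  shows "partition_entropy \<nu> (iterated_join \<nu> shift P n) \<le> real n * (\<integral>x. (if x \<in> guess x then ln 2 else ln (2 * real (card P))) \<partial>\<nu>)
     - real (n + m) * (\<integral>x. s (x 0) \<partial>\<nu>)"
proof -
  have finP: "finite P" and setsP: "\<And>A. A \<in> P \<Longrightarrow> A \<in> sets \<nu>" and part: "partition_on (shift_space M) P"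
    using P by (auto simp: finite_measurable_partitions_def space_eq)
  have "P \<noteq> {}" using guess by auto
  then have card: "0 < real (card P)" using finP by (simp add: card_gt_0_iff)
  have disj: "A = A'" if "A \<in> P" "A' \<in> P" "y \<in> A" "y \<in> A'" for A A' y
    using part that unfolding partition_on_def disjoint_def by blast
  let ?k = "real (card P)" and ?J = "iterated_join \<nu> shift P n" and ?N = "n + m"
  let ?W = "{w :: nat list. length w = ?N}"
  let ?L = "\<lambda>x. if x \<in> guess x then ln 2 else ln (2 * ?k)"
  \<comment> \<open>The code length: the price of the guesses at times below \<open>n\<close> plus
    the price of the first \<open>n + m\<close> letters.\<close>
  define G where "G x = (\<Sum>i<n. ?L ((shift ^^ i) x)) - (\<Sum>i<?N. s (((shift ^^ i) x) 0))" for x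
  have intG: "integrable \<nu> G"
    unfolding G_def using integral_sum_funpow(1)[OF L] integral_sum_funpow(1)[OF s]
    by (rule Bochner_Integration.integrable_diff)
  have valG: "(\<integral>x. G x \<partial>\<nu>) = real n * (\<integral>x. ?L x \<partial>\<nu>) - real ?N * (\<integral>x. s (x 0) \<partial>\<nu>)"
    unfolding G_def
    by (simp only: Bochner_Integration.integral_diff[OF integral_sum_funpow(1)[OF L] integral_sum_funpow(1)[OF s]]
        integral_sum_funpow(2)[OF L] integral_sum_funpow(2)[OF s])
  have "\<forall>B\<in>?J. \<exists>a. (\<forall>i<n. a i \<in> P) \<and> B = {x \<in> space \<nu>. \<forall>i<n. (shift ^^ i) x \<in> a i}"
    by (auto simp: iterated_join_def)
  from bchoice[OF this] obtain a where a: "\<forall>B\<in>?J. (\<forall>i<n. a B i \<in> P) \<and>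
      B = {x \<in> space \<nu>. \<forall>i<n. (shift ^^ i) x \<in> a B i}" ..
  \<comment> \<open>\<open>guess\<close> read off a word, through any point that has this prefix.
    For a word that is no prefix of a point the value is arbitrary but still an atom, because
    \<open>guess\<close> takes values in \<open>P\<close> everywhere; the bound on the sum of the
    weights needs this.\<close>
  define g where "g v = guess (SOME x. x \<in> shift_space M \<and> (\<forall>i<m. x i = v ! i))" for v
  have g_eq: "g v = guess x" if "x \<in> shift_space M" "\<And>i. i < m \<Longrightarrow> x i = v ! i" for x v
  proof -
    let ?y = "SOME x. x \<in> shift_space M \<and> (\<forall>i<m. x i = v ! i)"
    have "?y \<in> shift_space M \<and> (\<forall>i<m. ?y i = v ! i)"
      by (rule someI[of _ x]) (use that in auto)
    then have "guess ?y = guess x"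
      using that by (intro dep[unfolded depends_on_prefix_def, rule_format]) auto
    then show ?thesis by (simp only: g_def)
  qed
  \<comment> \<open>Weight one half goes to the guessed atom, and each other atom gets its share of
    the remaining half divided by \<open>?k\<close>. Hence the price \<open>ln 2\<close> for a
    correct guess and \<open>ln (2 * ?k)\<close> for a wrong one.\<close>
  define \<kappa> where "\<kappa> A v = (if g v = A then 1 / 2 else 1 / (2 * ?k))" for A v
  have \<kappa>0: "0 \<le> \<kappa> A v" for A v by (simp add: \<kappa>_def)
  have \<kappa>1: "(\<Sum>A\<in>P. \<kappa> A v) \<le> 1" for v
  proof -
    have "(\<Sum>A\<in>P. \<kappa> A v) \<le> (\<Sum>A\<in>P. (if A = g v then 1 / 2 else 0) + 1 / (2 * ?k))"
      by (intro sum_mono) (auto simp: \<kappa>_def)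
    also have "\<dots> = 1"
      using finP guess card \<open>P \<noteq> {}\<close> by (simp add: sum.distrib g_def)
    finally show ?thesis .
  qed
  define r where "r B w = (\<Prod>i<n. \<kappa> (a B i) (drop i w))" for B w
  have r0: "0 \<le> r B w" for B w unfolding r_def by (intro prod_nonneg) (simp add: \<kappa>0)
  have r1: "(\<Sum>B\<in>?J. r B w) \<le> 1" for w
  proof -
    have finJ: "finite ?J" using iterated_join_partition[OF P] by (auto simp: finite_measurable_partitions_def)
    have inj: "inj_on (\<lambda>B. restrict (a B) {..<n}) ?J"
    proof (rule inj_onI)
      fix B B' assume B: "B \<in> ?J" "B' \<in> ?J" and eq: "restrict (a B) {..<n} = restrict (a B') {..<n}"
      have "a B i = a B' i" if "i < n" for i
        using fun_cong[OF eq, of i] that by simp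
      then have "{x \<in> space \<nu>. \<forall>i<n. (shift ^^ i) x \<in> a B i} = {x \<in> space \<nu>. \<forall>i<n. (shift ^^ i) x \<in> a B' i}"
        by auto
      then show "B = B'" using bspec[OF a B(1)] bspec[OF a B(2)] by simp
    qed
    have "(\<Sum>B\<in>?J. r B w) = (\<Sum>b\<in>(\<lambda>B. restrict (a B) {..<n}) ` ?J. \<Prod>i<n. \<kappa> (b i) (drop i w))"
      by (subst sum.reindex[OF inj]) (auto simp: r_def intro!: sum.cong prod.cong)
    also have "\<dots> \<le> (\<Sum>b\<in>{..<n} \<rightarrow>\<^sub>E P. \<Prod>i<n. \<kappa> (b i) (drop i w))"
      using a finP by (intro sum_mono2) (auto intro!: finite_PiE prod_nonneg \<kappa>0)
    also have "\<dots> = (\<Prod>i<n. \<Sum>A\<in>P. \<kappa> A (drop i w))"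
      using finP by (subst prod_sum_PiE) auto
    also have "\<dots> \<le> 1"
      using \<kappa>0 \<kappa>1 by (intro prod_le_1) (auto intro!: sum_nonneg)
    finally show ?thesis .
  qed
  define c where "c w = (\<Prod>i<?N. exp (s (w ! i)))" for w
  have c0: "0 \<le> c w" for w unfolding c_def by (intro prod_nonneg) simp
  have c1: "(\<integral>\<^sup>+w. ennreal (c w) \<partial>count_space ?W) \<le> 1"
  proof -
    have "(\<integral>\<^sup>+w. ennreal (c w) \<partial>count_space ?W) = (\<integral>\<^sup>+w. (\<Prod>i<?N. ennreal (exp (s (w ! i)))) \<partial>count_space ?W)"
      by (intro nn_integral_cong) (simp add: c_def prod_ennreal)
    also have "\<dots> = (\<integral>\<^sup>+i. ennreal (exp (s i)) \<partial>count_space UNIV) ^ ?N"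
      by (rule nn_integral_words)
    also have "\<dots> \<le> 1" using s1 by (rule power_le_one[rotated]) simp
    finally show ?thesis .
  qed
  \<comment> \<open>The marginal weight of the itinerary. Only the term of the actual prefix of a
    point is needed for the lower bound, but the full sum is what makes the total at most 1.\<close>
  define Q where "Q B = (\<integral>\<^sup>+w. ennreal (c w * r B w) \<partial>count_space ?W)" for B
  have Qsum: "(\<Sum>B\<in>?J. Q B) \<le> 1"
  proof -
    have "(\<Sum>B\<in>?J. Q B) = (\<integral>\<^sup>+w. (\<Sum>B\<in>?J. ennreal (c w * r B w)) \<partial>count_space ?W)"
      unfolding Q_def by (rule nn_integral_sum[symmetric]) simp
    also have "\<dots> \<le> (\<integral>\<^sup>+w. ennreal (c w) \<partial>count_space ?W)"
    proof (intro nn_integral_mono)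
      fix w
      have "(\<Sum>B\<in>?J. ennreal (c w * r B w)) = ennreal (c w * (\<Sum>B\<in>?J. r B w))"
        using c0 r0 by (simp add: sum_ennreal sum_distrib_left)
      also have "\<dots> \<le> ennreal (c w)"
        using c0 r1 by (intro ennreal_leI) (simp add: mult_left_le)
      finally show "(\<Sum>B\<in>?J. ennreal (c w * r B w)) \<le> ennreal (c w)" .
    qed
    also have "\<dots> \<le> 1" by (rule c1)
    finally show ?thesis .
  qed
  have finJ: "finite ?J" using iterated_join_partition[OF P] by (auto simp: finite_measurable_partitions_def)
  have Qfin: "Q B \<le> 1" if "B \<in> ?J" for B
    using order_trans[OF member_le_sum[of B ?J Q] Qsum] that finJ by auto
  have "partition_entropy \<nu> ?J \<le> (\<integral>x. G x \<partial>\<nu>)"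
  proof (rule partition_entropy_le_pointwise[OF iterated_join_partition[OF P] intG, where q = "\<lambda>B. enn2real (Q B)"])
    fix B x assume B: "B \<in> ?J" and x: "x \<in> B"
    have xs: "x \<in> shift_space M" and xa: "\<And>i. i < n \<Longrightarrow> (shift ^^ i) x \<in> a B i"
      using bspec[OF a B] x by (auto simp: space_eq)
    let ?w = "map x [0..<?N]"
    have nth: "?w ! i = x i" if "i < ?N" for i using that by simp
    have \<kappa>L: "\<kappa> (a B i) (drop i ?w) = exp (- ?L ((shift ^^ i) x))" if i: "i < n" for i
    proof -
      have "g (drop i ?w) = guess ((shift ^^ i) x)"
      proof (rule g_eq)
        show "(shift ^^ i) x \<in> shift_space M" using xs by (rule funpow_shift_in_shift_space)
        show "(shift ^^ i) x j = drop i ?w ! j" if "j < m" for j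
          using i that by (simp add: shift_funpow add.commute)
      qed
      moreover have aP: "a B i \<in> P" using bspec[OF a B] i by blast
      have "(shift ^^ i) x \<in> guess ((shift ^^ i) x) \<longleftrightarrow> guess ((shift ^^ i) x) = a B i"
        using disj[OF guess aP _ xa[OF i]] xa[OF i] by auto
      ultimately show ?thesis
        using card by (auto simp: \<kappa>_def exp_minus inverse_eq_divide)
    qed
    have "exp (- G x) = exp (\<Sum>i<?N. s (x i)) * exp (\<Sum>i<n. - ?L ((shift ^^ i) x))"
      unfolding G_def sum_negf by (simp add: exp_add[symmetric] shift_funpow)
    also have "\<dots> = c ?w * r B ?w"
      unfolding exp_sum[OF finite_lessThan] c_def r_def by (intro arg_cong2[of _ _ _ _ "(*)"] prod.cong) (auto simp: \<kappa>L)
    finally have eq: "exp (- G x) = c ?w * r B ?w" .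
    have "ennreal (c ?w * r B ?w) \<le> Q B"
      unfolding Q_def by (rule nn_integral_ge_point) simp
    then have "enn2real (ennreal (c ?w * r B ?w)) \<le> enn2real (Q B)"
      using Qfin[OF B] by (intro enn2real_mono) (auto simp: less_top[symmetric] top_unique)
    then show "exp (- G x) \<le> enn2real (Q B)" unfolding eq using c0 r0 by simp
  next
    have "(\<Sum>B\<in>?J. enn2real (Q B)) = enn2real (\<Sum>B\<in>?J. Q B)"
      using enn2real_sum[of ?J Q, OF order.strict_trans1[OF Qfin ennreal_one_less_top]] by (simp add: o_def)
    also have "\<dots> \<le> 1" using Qsum enn2real_mono[of _ 1] by simp
    finally show "(\<Sum>B\<in>?J. enn2real (Q B)) \<le> 1" .
  qed simp
  then show ?thesis by (simp only: valG)
qed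

text \<open>The letters cost minus the integral of \<open>s\<close> per symbol. The guesses cost
  \<open>ln 2\<close>, plus at most 1 for errors, whatever the size of the partition, because the
  probability of error may be chosen after the partition.\<close>

lemma KS_entropy_le:
  assumes s: "integrable \<nu> (\<lambda>x. s (x 0))" and s1: "(\<integral>\<^sup>+i. ennreal (exp (s i)) \<partial>count_space UNIV) \<le> 1"
  shows "KS_entropy \<nu> shift \<le> ereal (ln 2 + 1 - (\<integral>x. s (x 0) \<partial>\<nu>))"
  unfolding KS_entropy_def
proof (rule SUP_least)
  fix P assume P: "P \<in> finite_measurable_partitions \<nu>"
  let ?k = "real (card P)" and ?S = "\<integral>x. s (x 0) \<partial>\<nu>"
  have finP: "finite P" using P by (auto simp: finite_measurable_partitions_def)
  have "P \<noteq> {}" using sum_prob_partition[OF P] by auto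
  then have card: "1 \<le> ?k" using finP by (simp add: Suc_leI card_gt_0_iff)
  have lnk: "0 < ln (2 * ?k)" using card by simp
  \<comment> \<open>The error probability is below the reciprocal of the price of a wrong guess, so
    that errors cost less than 1 on average.\<close>
  obtain m guess where dep: "depends_on_prefix M m guess" and guess: "\<And>x. guess x \<in> P"
    and wrong: "{x \<in> shift_space M. x \<notin> guess x} \<in> sets \<nu>" "prob {x \<in> shift_space M. x \<notin> guess x} < 1 / ln (2 * ?k)"
    using approximate_partition[OF P, of "1 / ln (2 * ?k)"] lnk by auto
  let ?D = "{x \<in> shift_space M. x \<notin> guess x}"
  let ?L = "\<lambda>x. if x \<in> guess x then ln 2 else ln (2 * ?k)"
  have Leq: "?L x = ln 2 + (ln (2 * ?k) - ln 2) * indicator ?D x" if "x \<in> space \<nu>" for x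
    using that by (auto simp: indicator_def space_eq)
  have int: "integrable \<nu> (\<lambda>x. ln 2 + (ln (2 * ?k) - ln 2) * indicator ?D x :: real)"
    using wrong by (auto simp: emeasure_eq_measure)
  have L: "integrable \<nu> ?L"
    using int Leq by (subst Bochner_Integration.integrable_cong[OF refl]) auto
  have "(\<integral>x. ?L x \<partial>\<nu>) = ln 2 + (ln (2 * ?k) - ln 2) * prob ?D"
    using wrong Leq by (subst Bochner_Integration.integral_cong[OF refl])
      (auto simp: emeasure_eq_measure prob_space)
  also have "\<dots> \<le> ln 2 + ln (2 * ?k) * prob ?D"
    by (simp add: mult_right_mono)
  also have "\<dots> \<le> ln 2 + 1"
    using wrong(2) lnk by (simp add: field_simps)
  finally have L1: "(\<integral>x. ?L x \<partial>\<nu>) \<le> ln 2 + 1" .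
  have lim: "(\<lambda>n. ereal (ln 2 + 1 - ?S - real m * ?S / real n)) \<longlonglongrightarrow> ereal (ln 2 + 1 - ?S - 0)"
    by (intro tendsto_intros lim_const_over_n)
  have bound: "ereal (partition_entropy \<nu> (iterated_join \<nu> shift P n) / real n)
      \<le> ereal (ln 2 + 1 - ?S - real m * ?S / real n)" if n: "1 \<le> n" for n
  proof -
    have "partition_entropy \<nu> (iterated_join \<nu> shift P n) \<le> real n * (\<integral>x. ?L x \<partial>\<nu>) - real (n + m) * ?S"
      by (rule coded_join_entropy_le[OF P s s1 dep guess L])
    also have "\<dots> \<le> real n * (ln 2 + 1) - real (n + m) * ?S"
      using L1 by (simp add: mult_left_mono)
    finally show ?thesis using n by (simp add: field_simps)
  qed
  show "entropy_rate \<nu> shift P \<le> ereal (ln 2 + 1 - ?S)"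
    using LIMSEQ_le[OF entropy_rate_LIMSEQ[OF P] lim] bound by auto
qed

end

lemma invariant_shift_measureI:
  assumes "\<nu> \<in> invariant_measures M"
  shows "invariant_shift_measure \<nu> M"
proof -
  have sets: "sets \<nu> = sets (shift_borel M)" and "prob_space \<nu>"
    and inv: "\<And>A. A \<in> sets \<nu> \<Longrightarrow> emeasure \<nu> (shift -` A \<inter> space \<nu>) = emeasure \<nu> A"
    using assms by (auto simp: invariant_measures_def)
  interpret prob_space \<nu> by fact
  show ?thesis
  proof
    show "shift \<in> measurable \<nu> \<nu>"
      using shift_measurable by (simp cong: measurable_cong_sets[OF sets sets])
  qed (use sets inv in auto)
qed

section \<open>Almost-additive potentials and their means\<close>

lemma ext_integral_eq_integral:
  assumes "integrable \<mu> g"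
  shows "ext_integral \<mu> g = ereal (\<integral>x. g x \<partial>\<mu>)"
proof -
  have "(\<integral>\<^sup>+x. ennreal (g x) \<partial>\<mu>) \<noteq> \<top>" "(\<integral>\<^sup>+x. ennreal (- g x) \<partial>\<mu>) \<noteq> \<top>"
    using assms by (auto simp: real_integrable_def)
  then show ?thesis
    unfolding ext_integral_def real_lebesgue_integral_def[OF assms]
    by (cases "\<integral>\<^sup>+x. ennreal (g x) \<partial>\<mu>"; cases "\<integral>\<^sup>+x. ennreal (- g x) \<partial>\<mu>") (auto simp: top_ennreal_def)
qed

text \<open>An upper bound keeps the positive part finite, so a failure of integrability comes from
  the negative part.\<close>

lemma (in prob_space) ext_integral_eq_MInf:
  assumes g [measurable]: "g \<in> borel_measurable M" and b: "\<And>x. x \<in> space M \<Longrightarrow> g x \<le> b"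
    and ni: "\<not> integrable M g"
  shows "ext_integral M g = - \<infinity>"
proof -
  have "(\<integral>\<^sup>+x. ennreal (g x) \<partial>M) \<le> (\<integral>\<^sup>+x. ennreal b \<partial>M)"
    by (intro nn_integral_mono ennreal_leI b)
  also have "\<dots> = ennreal b" by (simp add: emeasure_space_1)
  finally have fin: "(\<integral>\<^sup>+x. ennreal (g x) \<partial>M) \<noteq> \<infinity>" by (auto simp: top_unique)
  then have "(\<integral>\<^sup>+x. ennreal (- g x) \<partial>M) = \<infinity>"
    using ni g by (auto simp: real_integrable_def)
  then show ?thesis
    using fin unfolding ext_integral_def
    by (cases "\<integral>\<^sup>+x. ennreal (g x) \<partial>M") auto
qed

text \<open>The existential constants of the hypotheses are fixed as parameters, which makes it
  possible to track them under scaling and to see that they do not depend on the measure or on the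
  orbit length.\<close>

locale aa_potential =
  fixes M :: "nat \<Rightarrow> nat \<Rightarrow> nat" and f :: potential and C b :: real
  assumes continuous: "continuous_potential M f"
    and C_nonneg: "0 \<le> C"
    and lower_additive: "\<And>n m x. 1 \<le> n \<Longrightarrow> 1 \<le> m \<Longrightarrow> x \<in> shift_space M \<Longrightarrow>
      f n x + f m ((shift ^^ n) x) - C \<le> f (n + m) x"
    and upper_additive: "\<And>n m x. 1 \<le> n \<Longrightarrow> 1 \<le> m \<Longrightarrow> x \<in> shift_space M \<Longrightarrow>
      f (n + m) x \<le> f n x + f m ((shift ^^ n) x) + C"
    and bounded_above: "\<And>x. x \<in> shift_space M \<Longrightarrow> f 1 x \<le> b"
begin

text \<open>Each of the \<open>n\<close> joints between consecutive symbols costs \<open>C\<close>.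
  The error is linear in \<open>n\<close>, hence too coarse for the mean itself; it serves
  integrability, upper bounds and summability.\<close>

lemma abs_diff_birkhoff_sum_le:
  assumes "x \<in> shift_space M"
  shows "\<bar>f (Suc n) x - (\<Sum>i<Suc n. f 1 ((shift ^^ i) x))\<bar> \<le> real n * C"
proof (induction n)
  case (Suc n)
  have "\<bar>f (Suc n + 1) x - f (Suc n) x - f 1 ((shift ^^ Suc n) x)\<bar> \<le> C"
    using lower_additive[of "Suc n" 1 x] upper_additive[of "Suc n" 1 x] assms by simp
  with Suc show ?case by (simp add: algebra_simps)
qed simp

lemma potential_le:
  assumes "1 \<le> n" "x \<in> shift_space M"
  shows "f n x \<le> real n * (b + C)"
proof -
  have "(\<Sum>i<n. f 1 ((shift ^^ i) x)) \<le> real n * b"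
    using sum_bounded_above[of "{..<n}" "\<lambda>i. f 1 ((shift ^^ i) x)" b]
      bounded_above[OF funpow_shift_in_shift_space[OF assms(2)]] by simp
  moreover have "f n x \<le> (\<Sum>i<n. f 1 ((shift ^^ i) x)) + real (n - 1) * C"
    using abs_diff_birkhoff_sum_le[OF assms(2), of "n - 1"] assms(1) by (simp add: abs_le_iff)
  moreover have "real (n - 1) * C \<le> real n * C"
    using C_nonneg by (intro mult_right_mono) auto
  ultimately show ?thesis by (simp add: algebra_simps)
qed

context
  fixes \<nu> :: "(nat \<Rightarrow> nat) measure"
  assumes \<nu>: "\<nu> \<in> invariant_measures M"
begin

interpretation invariant_shift_measure \<nu> M by (rule invariant_shift_measureI[OF \<nu>])

lemma potential_borel_measurable: "1 \<le> n \<Longrightarrow> f n \<in> borel_measurable \<nu>"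
  using continuous continuous_borel_measurable[of M "f n"]
  by (simp add: continuous_potential_def cong: measurable_cong_sets[OF sets_eq refl])

text \<open>From \<open>n\<close> to 1: splitting off the first symbol and bounding the rest from
  above gives \<open>f 1 \<ge> f n - ?K\<close>, and \<open>f 1\<close> is bounded above. The
  converse is the comparison with the Birkhoff sum. So integrability of \<open>f 1\<close> decides
  whether the mean is finite.\<close>

lemma integrable_potential_iff:
  assumes n: "1 \<le> n"
  shows "integrable \<nu> (f n) \<longleftrightarrow> integrable \<nu> (f 1)"
proof
  assume fn: "integrable \<nu> (f n)"
  show "integrable \<nu> (f 1)"
  proof (cases "n = 1")
    case False
    let ?K = "real (n - 1) * (b + C) + C"
    show ?thesis
    proof (rule Bochner_Integration.integrable_bound)
      show "integrable \<nu> (\<lambda>x. \<bar>f n x\<bar> + (\<bar>?K\<bar> + \<bar>b\<bar>))" using fn by simp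
      show "f 1 \<in> borel_measurable \<nu>" by (rule potential_borel_measurable) simp
      show "AE x in \<nu>. norm (f 1 x) \<le> norm (\<bar>f n x\<bar> + (\<bar>?K\<bar> + \<bar>b\<bar>))"
      proof (rule AE_I2)
        fix x assume "x \<in> space \<nu>"
        then have x: "x \<in> shift_space M" by (simp add: space_eq)
        have "f n x \<le> f 1 x + f (n - 1) ((shift ^^ 1) x) + C"
          using upper_additive[of 1 "n - 1" x] x n False by simp
        also have "\<dots> \<le> f 1 x + ?K"
          using potential_le[OF _ funpow_shift_in_shift_space[OF x], of "n - 1" 1] n False by simp
        finally have "f n x \<le> f 1 x + ?K" .
        moreover have "f 1 x \<le> b" using bounded_above[OF x] .
        ultimately show "norm (f 1 x) \<le> norm (\<bar>f n x\<bar> + (\<bar>?K\<bar> + \<bar>b\<bar>))"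
          unfolding real_norm_def by linarith
      qed
    qed
  qed (use fn in simp)
next
  assume f1: "integrable \<nu> (f 1)"
  show "integrable \<nu> (f n)"
  proof (rule Bochner_Integration.integrable_bound)
    let ?S = "\<lambda>x. \<Sum>i<n. f 1 ((shift ^^ i) x)"
    show "integrable \<nu> (\<lambda>x. \<bar>?S x\<bar> + real (n - 1) * C)"
      using integral_sum_funpow(1)[OF f1, of n] by simp
    show "f n \<in> borel_measurable \<nu>" by (rule potential_borel_measurable[OF n])
    show "AE x in \<nu>. norm (f n x) \<le> norm (\<bar>?S x\<bar> + real (n - 1) * C)"
    proof (rule AE_I2)
      fix x assume "x \<in> space \<nu>"
      then have "\<bar>f n x - ?S x\<bar> \<le> real (n - 1) * C"
        using abs_diff_birkhoff_sum_le[of x "n - 1"] n by (simp add: space_eq)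
      then show "norm (f n x) \<le> norm (\<bar>?S x\<bar> + real (n - 1) * C)"
        unfolding real_norm_def by linarith
    qed
  qed
qed

lemma mean_potential_eq_MInf:
  assumes "\<not> integrable \<nu> (f 1)"
  shows "mean_potential f \<nu> = - \<infinity>"
proof -
  have "ereal (1 / real n) * ext_integral \<nu> (f n) = - \<infinity>" if n: "1 \<le> n" for n
  proof -
    have "ext_integral \<nu> (f n) = - \<infinity>"
      using assms potential_borel_measurable[OF n] potential_le[OF n] integrable_potential_iff[OF n]
      by (intro ext_integral_eq_MInf) (auto simp: space_eq)
    then show ?thesis using n by simp
  qed
  then have "(\<lambda>n. ereal (1 / real n) * ext_integral \<nu> (f n)) \<longlonglongrightarrow> - \<infinity>"
    by (intro tendsto_eventually eventually_sequentiallyI)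
  then show ?thesis unfolding mean_potential_def by (rule limI)
qed

text \<open>Both \<open>?I n + C\<close> and \<open>C - ?I n\<close> are subadditive, so their
  averages converge to their infima. The two limits add up to the limit of \<open>2 * C / n\<close>,
  which is 0, so both are finite and opposite; that they are infima gives the error bound
  \<open>C\<close> for every single \<open>n\<close>.\<close>

lemma mean_potential_integrable:
  assumes f1: "integrable \<nu> (f 1)"
  obtains A where "mean_potential f \<nu> = ereal A"
    "\<And>n. 1 \<le> n \<Longrightarrow> \<bar>(\<integral>x. f n x \<partial>\<nu>) - real n * A\<bar> \<le> C"
proof -
  let ?I = "\<lambda>n. \<integral>x. f n x \<partial>\<nu>"
  have fn: "integrable \<nu> (f n)" if "1 \<le> n" for n
    using integrable_potential_iff[OF that] f1 by simp
  have add: "\<bar>?I (n + m) - ?I n - ?I m\<bar> \<le> C" if nm: "1 \<le> n" "1 \<le> m" for n m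
  proof -
    note fm = integrable_funpow[OF fn[OF nm(2)], of n]
    have val: "(\<integral>x. f n x + f m ((shift ^^ n) x) \<partial>\<nu>) = ?I n + ?I m"
      by (simp add: Bochner_Integration.integral_add[OF fn[OF nm(1)] fm]
          integral_funpow[OF borel_measurable_integrable[OF fn[OF nm(2)]]])
    note int = Bochner_Integration.integrable_add[OF fn[OF nm(1)] fm]
    have "?I (n + m) \<le> (\<integral>x. f n x + f m ((shift ^^ n) x) + C \<partial>\<nu>)"
      using upper_additive[OF nm] fn nm int by (intro integral_mono) (auto simp: space_eq)
    moreover have "(\<integral>x. f n x + f m ((shift ^^ n) x) - C \<partial>\<nu>) \<le> ?I (n + m)"
      using lower_additive[OF nm] fn nm int by (intro integral_mono) (auto simp: space_eq)
    ultimately show ?thesis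
      using int val by (simp add: prob_space)
  qed
  let ?X = "INF n\<in>{1..}. ereal ((?I n + C) / real n)" and ?Y = "INF n\<in>{1..}. ereal ((C - ?I n) / real n)"
  have X: "(\<lambda>n. ereal ((?I n + C) / real n)) \<longlonglongrightarrow> ?X"
    by (rule fekete) (use add in \<open>force simp: abs_le_iff\<close>)+
  have Y: "(\<lambda>n. ereal ((C - ?I n) / real n)) \<longlonglongrightarrow> ?Y"
    by (rule fekete) (use add in \<open>force simp: abs_le_iff\<close>)+
  have Xle: "?X \<le> ereal ((?I n + C) / real n)" and Yle: "?Y \<le> ereal ((C - ?I n) / real n)" if "1 \<le> n" for n
    using that by (auto intro!: INF_lower)
  have C0: "(\<lambda>n. ereal (2 * C / real n)) \<longlonglongrightarrow> ereal 0"
    by (intro tendsto_intros lim_const_over_n)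
  \<comment> \<open>Excluding plus infinity on both sides is enough for the addition of limits in
    \<open>ereal\<close>; that the sum is 0 then excludes minus infinity.\<close>
  have nX: "?X \<noteq> \<infinity>" and nY: "?Y \<noteq> \<infinity>"
    using Xle[of 1] Yle[of 1] by auto
  have "(\<lambda>n. ereal ((?I n + C) / real n) + ereal ((C - ?I n) / real n)) \<longlonglongrightarrow> ?X + ?Y"
    using nX nY by (intro tendsto_add_ereal_general X Y) auto
  then have S: "(\<lambda>n. ereal (2 * C / real n)) \<longlonglongrightarrow> ?X + ?Y"
    by (simp add: add_divide_distrib[symmetric])
  have XY: "?X + ?Y = 0"
    using LIMSEQ_unique[OF S C0] by (simp only: zero_ereal_def)
  have "\<exists>A. x = ereal A \<and> y = ereal (- A)" if "x + y = 0" "x \<noteq> \<infinity>" "y \<noteq> \<infinity>" for x y :: ereal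
    using that by (cases x; cases y) (auto simp: zero_ereal_def)
  from this[OF XY nX nY] obtain A where A: "?X = ereal A" "?Y = ereal (- A)" by blast
  have "(\<lambda>n. ereal ((?I n + C) / real n) + ereal (- C / real n)) \<longlonglongrightarrow> ereal A + ereal 0"
    using X unfolding A(1) by (intro tendsto_intros tendsto_add_ereal_general lim_const_over_n) auto
  moreover have "eventually (\<lambda>n. ereal ((?I n + C) / real n) + ereal (- C / real n) =
      ereal (1 / real n) * ext_integral \<nu> (f n)) sequentially"
    by (rule eventually_sequentiallyI[of 1])
       (simp add: ext_integral_eq_integral[OF fn] add_divide_distrib)
  ultimately have "(\<lambda>n. ereal (1 / real n) * ext_integral \<nu> (f n)) \<longlonglongrightarrow> ereal A + ereal 0"
    by (rule Lim_transform_eventually)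
  then have "mean_potential f \<nu> = ereal A"
    unfolding mean_potential_def by (simp add: limI)
  moreover have "\<bar>?I n - real n * A\<bar> \<le> C" if n: "1 \<le> n" for n
    using Xle[OF n] Yle[OF n] n unfolding A by (auto simp: field_simps abs_le_iff)
  ultimately show ?thesis using that by blast
qed

end

end

section \<open>Periodic points and the Gurevich pressure\<close>

text \<open>Words are represented by points together with a length: a point \<open>x\<close> stands
  for its first \<open>n\<close> letters, with \<open>x n\<close> as the letter at which the next
  block must begin. Blocks of lengths \<open>n\<close> and \<open>m\<close> thus glue to length
  \<open>n + m\<close>, and \<open>f n\<close> can be evaluated on a block without choosing an
  extension.\<close>

definition splice :: "nat \<Rightarrow> (nat \<Rightarrow> nat) \<Rightarrow> (nat \<Rightarrow> nat) \<Rightarrow> (nat \<Rightarrow> nat)" where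
  "splice n x y = (\<lambda>i. if i < n then x i else y (i - n))"

definition periodic_extension :: "nat \<Rightarrow> (nat \<Rightarrow> nat) \<Rightarrow> (nat \<Rightarrow> nat)" where
  "periodic_extension n x = (\<lambda>i. x (i mod n))"

definition periodic_points :: "(nat \<Rightarrow> nat \<Rightarrow> nat) \<Rightarrow> nat \<Rightarrow> nat \<Rightarrow> (nat \<Rightarrow> nat) set" where
  "periodic_points M n a = {x \<in> shift_space M. (shift ^^ n) x = x \<and> x 0 = a}"

lemma splice_in_shift_space:
  assumes "x \<in> shift_space M" "y \<in> shift_space M" "x n = y 0"
  shows "splice n x y \<in> shift_space M"
proof -
  have "M (splice n x y i) (splice n x y (Suc i)) = 1" for i
  proof -
    consider "Suc i < n" | "Suc i = n" | "n \<le> i" by linarith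
    then show ?thesis
    proof cases
      case 2
      then have "splice n x y (Suc i) = x (Suc i)" using assms(3) by (simp add: splice_def)
      moreover have "splice n x y i = x i" using 2 by (simp add: splice_def)
      ultimately show ?thesis using assms(1) by (simp add: shift_space_def)
    qed (use assms in \<open>auto simp: splice_def shift_space_def Suc_diff_le\<close>)
  qed
  then show ?thesis by (simp add: shift_space_def)
qed

lemma splice_less: "i < n \<Longrightarrow> splice n x y i = x i"
  by (simp add: splice_def)

lemma splice_add: "splice n x y (n + i) = y i" "splice n x y n = y 0"
  by (simp_all add: splice_def)

lemma shift_funpow_splice: "(shift ^^ n) (splice n x y) = y"
  by (simp add: shift_funpow splice_def)

lemma periodic_extension_in_periodic_points:
  assumes "1 \<le> n" "x \<in> shift_space M" "x n = x 0"
  shows "periodic_extension n x \<in> periodic_points M n (x 0)"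
proof -
  have "M (x (i mod n)) (x (Suc i mod n)) = 1" for i
    using assms by (auto simp: mod_Suc shift_space_def dest: spec[of _ "i mod n"])
  then show ?thesis
    by (simp add: periodic_points_def shift_space_def shift_funpow periodic_extension_def)
qed

lemma periodic_extension_less: "i < n \<Longrightarrow> periodic_extension n x i = x i"
  by (simp add: periodic_extension_def)

lemma periodic_points_mod:
  assumes "x \<in> periodic_points M n a"
  shows "x i = x (i mod n)"
proof -
  have "(shift ^^ n) x = x" using assms by (simp add: periodic_points_def)
  from fun_cong[OF this] have per: "x (i + n) = x i" for i unfolding shift_funpow .
  have "x (i + k * n) = x i" for i k
    by (induction k) (auto simp: per add.assoc[symmetric] add.commute[of n])
  from this[of "i mod n" "i div n"] show ?thesis by simp
qed

lemma periodic_points_eqI: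
  assumes "x \<in> periodic_points M n a" "y \<in> periodic_points M n b" "1 \<le> n" "\<And>i. i < n \<Longrightarrow> x i = y i"
  shows "x = y"
proof
  fix i
  show "x i = y i"
    using periodic_points_mod[OF assms(1), of i] periodic_points_mod[OF assms(2), of i]
      assms(3,4) by simp
qed

lemma periodic_points_return:
  assumes "x \<in> periodic_points M n a"
  shows "x n = a \<and> x 0 = a \<and> x \<in> shift_space M"
  using assms periodic_points_mod[OF assms, of n] by (simp add: periodic_points_def)

lemma exists_point_from_letter:
  assumes "transition_matrix M"
  obtains q where "q \<in> shift_space M" "q 0 = a"
proof -
  have "\<exists>nx. \<forall>i. M i (nx i) = 1"
    using assms by (intro choice) (simp add: transition_matrix_def)
  then obtain nx where nx: "\<And>i. M i (nx i) = 1" by blast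
  have "(\<lambda>i. (nx ^^ i) a) \<in> shift_space M" by (simp add: shift_space_def nx)
  then show ?thesis using that[of "\<lambda>i. (nx ^^ i) a"] by simp
qed

text \<open>Mixing provides a word; since no row of the matrix is zero, it extends to the right to a
  point of the shift space.\<close>

lemma eventually_connecting_point:
  assumes "transition_matrix M" "topologically_mixing M"
  shows "eventually (\<lambda>n. \<exists>x\<in>shift_space M. x 0 = a \<and> x n = b) sequentially"
proof -
  obtain N where N: "\<And>n. N \<le> n \<Longrightarrow> \<exists>w. admissible M w \<and> length w = n \<and> hd w = a \<and> last w = b"
    using assms(2) unfolding topologically_mixing_def by meson
  obtain q where q: "q \<in> shift_space M" "q 0 = b"
    using exists_point_from_letter[OF assms(1)] .
  show ?thesis
  proof (rule eventually_sequentiallyI[of N])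
    fix n assume "N \<le> n"
    \<comment> \<open>Length \<open>Suc n\<close> puts the final letter at index
      \<open>n\<close>.\<close>
    then obtain w where w: "admissible M w" "length w = Suc n" "hd w = a" "last w = b"
      using N[of "Suc n"] by auto
    have w0: "w ! 0 = a" and wn: "w ! n = b"
      using w by (auto simp: hd_conv_nth last_conv_nth admissible_def)
    let ?x = "splice n (\<lambda>i. w ! i) q"
    have "M (?x i) (?x (Suc i)) = 1" for i
    proof -
      consider "Suc i < n" | "Suc i = n" | "n \<le> i" by linarith
      then show ?thesis
      proof cases
        case 2
        then have "?x (Suc i) = w ! Suc i" "?x i = w ! i" using wn q(2) by (auto simp: splice_def)
        moreover have "M (w ! i) (w ! Suc i) = 1" using w(1,2) 2 by (auto simp: admissible_def)
        ultimately show ?thesis by simp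
      qed (use w q in \<open>auto simp: splice_def admissible_def shift_space_def Suc_diff_le\<close>)
    qed
    then have "?x \<in> shift_space M" by (simp add: shift_space_def)
    moreover have "?x 0 = a" using w0 wn q(2) by (cases n) (auto simp: splice_def)
    moreover have "?x n = b" by (simp add: splice_def q)
    ultimately show "\<exists>x\<in>shift_space M. x 0 = a \<and> x n = b" by blast
  qed
qed

lemma sum_words_le:
  fixes p :: "nat \<Rightarrow> real"
  assumes "\<And>i. 0 \<le> p i" "summable p" "finite W" "\<And>w. w \<in> W \<Longrightarrow> length w = n"
  shows "(\<Sum>w\<in>W. \<Prod>i<n. p (w ! i)) \<le> (\<Sum>i. p i) ^ n"
proof -
  have "ennreal (\<Sum>w\<in>W. \<Prod>i<n. p (w ! i)) = (\<Sum>w\<in>W. \<Prod>i<n. ennreal (p (w ! i)))"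
    using assms(1) by (simp add: prod_ennreal sum_ennreal prod_nonneg)
  also have "\<dots> = (\<integral>\<^sup>+w. (\<Prod>i<n. ennreal (p (w ! i))) \<partial>count_space W)"
    using assms(3) by (simp add: nn_integral_count_space_finite)
  also have "\<dots> \<le> (\<integral>\<^sup>+w. (\<Prod>i<n. ennreal (p (w ! i))) \<partial>count_space {w. length w = n})"
    using assms(4) by (subst (1 2) nn_integral_count_space_indicator)
      (auto intro!: nn_integral_mono simp: indicator_def)
  also have "\<dots> = ennreal (\<Sum>i. p i) ^ n"
    using assms(1,2) by (subst nn_integral_words[where p = "\<lambda>i. ennreal (p i)"])
      (simp add: nn_integral_count_space_nat suminf_ennreal2)
  also have "\<dots> = ennreal ((\<Sum>i. p i) ^ n)"
    using assms(1,2) by (simp add: ennreal_power suminf_nonneg)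
  finally show ?thesis
    using assms(1,2) by (simp add: suminf_nonneg)
qed

text \<open>The weights \<open>p\<close> are only required to dominate \<open>exp (f 1 x)\<close>
  letter by letter, not to be the suprema. In this form the scaled potentials are instances again,
  with weights proportional to \<open>p\<close>.\<close>

locale summable_aa_potential = aa_potential +
  fixes D :: real and p :: "nat \<Rightarrow> real"
  assumes transition: "transition_matrix M" and mixing: "topologically_mixing M"
    and D_nonneg: "0 \<le> D"
    and variation: "\<And>n x y. 1 \<le> n \<Longrightarrow> x \<in> shift_space M \<Longrightarrow> y \<in> shift_space M \<Longrightarrow>
      (\<And>i. i < n \<Longrightarrow> x i = y i) \<Longrightarrow> \<bar>f n x - f n y\<bar> \<le> D"
    and p: "\<And>i. 0 \<le> p i" "summable p" "\<And>x. x \<in> shift_space M \<Longrightarrow> exp (f 1 x) \<le> p (x 0)"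
begin

text \<open>Gluing costs \<open>C\<close> for cutting the orbit at time \<open>n\<close> and
  \<open>D\<close> for replacing the spliced point by \<open>x\<close> on the first block. The
  second block costs nothing more, since the shifted splice is exactly \<open>y\<close>.\<close>

lemma splice_lower:
  assumes "1 \<le> n" "1 \<le> m" "x \<in> shift_space M" "y \<in> shift_space M" "x n = y 0"
  shows "f n x + f m y - (C + D) \<le> f (n + m) (splice n x y)"
proof -
  have s: "splice n x y \<in> shift_space M" by (rule splice_in_shift_space[OF assms(3-5)])
  have "\<bar>f n x - f n (splice n x y)\<bar> \<le> D"
    by (rule variation[OF assms(1,3) s]) (simp add: splice_less)
  then show ?thesis
    using lower_additive[OF assms(1,2) s] by (simp add: shift_funpow_splice)
qed

lemma periodic_extension_lower:
  assumes "1 \<le> n" "x \<in> shift_space M" "x n = x 0"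
  shows "f n x - D \<le> f n (periodic_extension n x)"
proof -
  have "periodic_extension n x \<in> shift_space M"
    using periodic_extension_in_periodic_points[OF assms] by (simp add: periodic_points_def)
  then have "\<bar>f n x - f n (periodic_extension n x)\<bar> \<le> D"
    by (rule variation[OF assms(1,2)]) (simp add: periodic_extension_less)
  then show ?thesis by linarith
qed

section \<open>Partition functions over periodic points\<close>

definition Z :: "nat \<Rightarrow> nat \<Rightarrow> real" where
  "Z a n = infsum (\<lambda>x. exp (f n x)) (periodic_points M n a)"

text \<open>A periodic point is determined by its first \<open>n\<close> letters, so the sum is
  dominated by a sum over words, which is an \<open>n\<close>-th power; \<open>exp C\<close> per
  symbol pays for passing to the Birkhoff sum.\<close>

lemma finite_periodic_sum_le:
  assumes n: "1 \<le> n" and F: "finite F" "F \<subseteq> periodic_points M n a"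
  shows "(\<Sum>x\<in>F. exp (f n x)) \<le> (exp C * (\<Sum>i. p i)) ^ n"
proof -
  have "(\<Sum>x\<in>F. exp (f n x)) \<le> (\<Sum>x\<in>F. exp C ^ n * (\<Prod>i<n. p (map x [0..<n] ! i)))"
  proof (rule sum_mono)
    fix x assume "x \<in> F"
    then have x: "x \<in> shift_space M" using F by (auto simp: periodic_points_def)
    have "f n x \<le> real n * C + (\<Sum>i<n. f 1 ((shift ^^ i) x))"
      using abs_diff_birkhoff_sum_le[OF x, of "n - 1"] n C_nonneg
        mult_right_mono[of "real (n - 1)" "real n" C] by (simp add: abs_le_iff)
    then have "exp (f n x) \<le> exp (real n * C) * exp (\<Sum>i<n. f 1 ((shift ^^ i) x))"
      by (simp add: exp_add[symmetric])
    also have "\<dots> = exp C ^ n * (\<Prod>i<n. exp (f 1 ((shift ^^ i) x)))"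
      by (simp add: exp_sum exp_of_nat_mult)
    also have "\<dots> \<le> exp C ^ n * (\<Prod>i<n. p (map x [0..<n] ! i))"
    proof (intro mult_left_mono prod_mono conjI)
      fix i assume "i \<in> {..<n}"
      then show "exp (f 1 ((shift ^^ i) x)) \<le> p (map x [0..<n] ! i)"
        using p(3)[OF funpow_shift_in_shift_space[OF x], of i] by (simp add: shift_funpow)
    qed auto
    finally show "exp (f n x) \<le> exp C ^ n * (\<Prod>i<n. p (map x [0..<n] ! i))" .
  qed
  also have "\<dots> = exp C ^ n * (\<Sum>w\<in>(\<lambda>x. map x [0..<n]) ` F. \<Prod>i<n. p (w ! i))"
  proof -
    have "inj_on (\<lambda>x. map x [0..<n]) F"
    proof (rule inj_onI)
      fix x y assume "x \<in> F" "y \<in> F" "map x [0..<n] = map y [0..<n]"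
      then show "x = y"
        using F n by (intro periodic_points_eqI[of x M n a y a]) auto
    qed
    then show ?thesis by (simp add: sum.reindex sum_distrib_left)
  qed
  also have "\<dots> \<le> exp C ^ n * (\<Sum>i. p i) ^ n"
    using F by (intro mult_left_mono sum_words_le p) auto
  finally show ?thesis by (simp add: power_mult_distrib)
qed

lemma summable_on_periodic_points:
  assumes "1 \<le> n"
  shows "(\<lambda>x. exp (f n x)) summable_on periodic_points M n a"
  using finite_periodic_sum_le[OF assms, of _ a]
  by (intro nonneg_bounded_partial_sums_imp_summable_on[where C = "(exp C * (\<Sum>i. p i)) ^ n"]
      eventually_finite_subsets_at_top_weakI) auto

lemma Z_le: "1 \<le> n \<Longrightarrow> Z a n \<le> (exp C * (\<Sum>i. p i)) ^ n"
  unfolding Z_def by (intro infsum_le_finite_sums summable_on_periodic_points finite_periodic_sum_le)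

lemma sum_le_Z: "1 \<le> n \<Longrightarrow> finite F \<Longrightarrow> F \<subseteq> periodic_points M n a \<Longrightarrow> (\<Sum>x\<in>F. exp (f n x)) \<le> Z a n"
  unfolding Z_def by (intro finite_sum_le_infsum summable_on_periodic_points) auto

lemma exp_le_Z: "1 \<le> n \<Longrightarrow> x \<in> periodic_points M n a \<Longrightarrow> exp (f n x) \<le> Z a n"
  using sum_le_Z[of n "{x}" a] by simp

lemma periodic_sum_eq_Z:
  assumes "1 \<le> n"
  shows "periodic_sum M f a n = ennreal (Z a n)"
proof -
  have "periodic_sum M f a n = infsum (\<lambda>x. ennreal (exp (f n x))) (periodic_points M n a)"
    unfolding periodic_sum_def
    by (rule infsum_cong_neutral) (auto simp: periodic_points_def cylinder_def indicator_def)
  also have "\<dots> = (SUP F\<in>{F. finite F \<and> F \<subseteq> periodic_points M n a}. \<Sum>x\<in>F. ennreal (exp (f n x)))"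
    by (rule nonneg_infsum_complete) simp
  also have "\<dots> = (SUP F\<in>{F. finite F \<and> F \<subseteq> periodic_points M n a}. ennreal (\<Sum>x\<in>F. exp (f n x)))"
    by (simp add: sum_ennreal)
  also have "\<dots> = ennreal (Z a n)"
    unfolding Z_def using summable_on_periodic_points[OF assms]
    by (intro infsum_nonneg_is_SUPREMUM_ennreal[symmetric]) auto
  finally show ?thesis .
qed

text \<open>Two loops at \<open>a\<close> are glued to a loop of the total length, injectively. The
  exponent is \<open>C + D\<close> for the splice and another \<open>D\<close> for the periodic
  closure.\<close>

lemma Z_mult_le:
  assumes n: "1 \<le> n" and m: "1 \<le> m"
  shows "Z a n * Z a m \<le> exp (C + 2 * D) * Z a (n + m)"
proof -
  let ?P = "\<lambda>n. periodic_points M n a"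
  let ?\<phi> = "\<lambda>(x, y). periodic_extension (n + m) (splice n x y)"
  let ?K = "exp (C + 2 * D)"
  have glue: "?\<phi> (x, y) \<in> ?P (n + m)" "exp (f n x) * exp (f m y) \<le> ?K * exp (f (n + m) (?\<phi> (x, y)))"
    if xy: "x \<in> ?P n" "y \<in> ?P m" for x y
  proof -
    note x = periodic_points_return[OF xy(1)] and y = periodic_points_return[OF xy(2)]
    have s: "splice n x y \<in> shift_space M" using x y by (intro splice_in_shift_space) auto
    have e: "splice n x y (n + m) = splice n x y 0" using x y n by (simp add: splice_def)
    have "splice n x y 0 = a" using x n by (simp add: splice_def)
    with periodic_extension_in_periodic_points[OF _ s e] n
    show "?\<phi> (x, y) \<in> ?P (n + m)" by simp
    have "f n x + f m y \<le> (C + 2 * D) + f (n + m) (?\<phi> (x, y))"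
      using splice_lower[OF n m, of x y] periodic_extension_lower[OF _ s e] x y n by simp
    then show "exp (f n x) * exp (f m y) \<le> ?K * exp (f (n + m) (?\<phi> (x, y)))"
      by (simp add: exp_add[symmetric])
  qed
  have inj: "inj_on ?\<phi> (?P n \<times> ?P m)"
  proof (rule inj_onI, clarsimp)
    fix x y x' y'
    assume xy: "x \<in> ?P n" "y \<in> ?P m" "x' \<in> ?P n" "y' \<in> ?P m"
      and eq: "periodic_extension (n + m) (splice n x y) = periodic_extension (n + m) (splice n x' y')"
    have eqi: "splice n x y i = splice n x' y' i" if "i < n + m" for i
      using fun_cong[OF eq, of i] that by (simp add: periodic_extension_less)
    have "x i = x' i" if "i < n" for i
      using eqi[of i] that by (simp add: splice_less)
    moreover have "y i = y' i" if "i < m" for i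
      using eqi[of "n + i"] that by (simp add: splice_add)
    ultimately show "x = x' \<and> y = y'"
      using periodic_points_eqI[OF xy(1,3) n] periodic_points_eqI[OF xy(2,4) m] by blast
  qed
  have fin: "(\<Sum>x\<in>F. exp (f n x)) * (\<Sum>y\<in>G. exp (f m y)) \<le> ?K * Z a (n + m)"
    if F: "finite F" "F \<subseteq> ?P n" and G: "finite G" "G \<subseteq> ?P m" for F G
  proof -
    have "(\<Sum>x\<in>F. exp (f n x)) * (\<Sum>y\<in>G. exp (f m y)) = (\<Sum>z\<in>F \<times> G. exp (f n (fst z)) * exp (f m (snd z)))"
      by (simp add: sum_product sum.cartesian_product case_prod_beta)
    also have "\<dots> \<le> (\<Sum>z\<in>F \<times> G. ?K * exp (f (n + m) (?\<phi> z)))"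
      using F G glue(2) by (intro sum_mono) (auto simp: subset_iff)
    also have "\<dots> = ?K * (\<Sum>z\<in>?\<phi> ` (F \<times> G). exp (f (n + m) z))"
      using inj_on_subset[OF inj, of "F \<times> G"] F G
      by (subst sum.reindex) (auto simp: sum_distrib_left)
    also have "\<dots> \<le> ?K * Z a (n + m)"
      using F G n glue(1) by (intro mult_left_mono sum_le_Z) (auto simp: subset_iff)
    finally show ?thesis .
  qed
  \<comment> \<open>The finite inequality is passed to the infinite sums one factor at a
    time.\<close>
  have fin': "(\<Sum>x\<in>F. exp (f n x)) * Z a m \<le> ?K * Z a (n + m)" if F: "finite F" "F \<subseteq> ?P n" for F
    unfolding Z_def[of a m] infsum_cmult_right'[symmetric]
    by (intro infsum_le_finite_sums summable_on_cmult_right summable_on_periodic_points[OF m])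
       (simp add: sum_distrib_left[symmetric] fin[OF F])
  show ?thesis
    unfolding Z_def[of a n] infsum_cmult_left'[symmetric]
    by (intro infsum_le_finite_sums summable_on_cmult_left summable_on_periodic_points[OF n])
       (simp add: sum_distrib_right[symmetric] fin')
qed

text \<open>An orbit segment of \<open>x\<close> is extended at both ends to begin and end at
  \<open>a\<close>, then repeated. Two splices and one periodic closure make up
  \<open>2 * C + 3 * D\<close>. That the letters of \<open>x\<close> survive from position
  \<open>k\<close> on is recorded because it yields injectivity.\<close>

lemma close_up:
  assumes n: "1 \<le> n" "1 \<le> k" "1 \<le> l"
    and pt: "u \<in> shift_space M" "x \<in> shift_space M" "v \<in> shift_space M"
    and ends: "u 0 = a" "u k = x 0" "x n = v 0" "v l = a"
  defines "z \<equiv> periodic_extension (k + (n + l)) (splice k u (splice n x v))"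
  shows "z \<in> periodic_points M (k + (n + l)) a"
    and "f k u + f n x + f l v - (2 * C + 3 * D) \<le> f (k + (n + l)) z"
    and "\<And>i. i < n \<Longrightarrow> z (k + i) = x i"
proof -
  have s1: "splice n x v \<in> shift_space M" by (rule splice_in_shift_space[OF pt(2,3) ends(3)])
  have "splice n x v 0 = x 0" using n by (simp add: splice_def)
  then have e1: "u k = splice n x v 0" using ends by simp
  have s2: "splice k u (splice n x v) \<in> shift_space M" by (rule splice_in_shift_space[OF pt(1) s1 e1])
  have s0: "splice k u (splice n x v) 0 = a" using n ends by (simp add: splice_def)
  have e2: "splice k u (splice n x v) (k + (n + l)) = splice k u (splice n x v) 0"
    unfolding s0 by (simp add: splice_add ends)
  show "z \<in> periodic_points M (k + (n + l)) a"
    using periodic_extension_in_periodic_points[OF _ s2 e2] n by (simp add: z_def s0)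
  show "f k u + f n x + f l v - (2 * C + 3 * D) \<le> f (k + (n + l)) z"
    using splice_lower[OF n(1,3) pt(2,3) ends(3)] splice_lower[OF n(2) _ pt(1) s1 e1, of "n + l"]
      periodic_extension_lower[OF _ s2 e2] n by (simp add: z_def)
  show "z (k + i) = x i" if "i < n" for i
    using that by (simp add: z_def periodic_extension_less splice_add splice_less)
qed

end

section \<open>Growth rates of the partition functions and the pressure\<close>

context summable_aa_potential
begin

lemma Z_pos: "eventually (\<lambda>n. 0 < Z a n) sequentially"
proof -
  have "eventually (\<lambda>n. 1 \<le> n \<and> (\<exists>x\<in>shift_space M. x 0 = a \<and> x n = a)) sequentially"
    using eventually_connecting_point[OF transition mixing, of a a] eventually_ge_at_top[of 1]
    by eventually_elim blast
  then show ?thesis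
  proof eventually_elim
    case (elim n)
    then obtain x where x: "x \<in> shift_space M" "x 0 = a" "x n = a" by blast
    with elim have "periodic_extension n x \<in> periodic_points M n a"
      using periodic_extension_in_periodic_points[of n x M] by simp
    from exp_le_Z[OF conjunct1[OF elim] this] show ?case
      using exp_gt_zero less_le_trans by blast
  qed
qed

text \<open>The multiplicative inequality for \<open>Z\<close> makes \<open>u\<close> subadditive at
  the indices where \<open>Z\<close> is positive. The infimum given by Fekete's lemma is finite
  because \<open>Z\<close> grows at most exponentially.\<close>

lemma ln_Z_LIMSEQ:
  obtains L :: real where "(\<lambda>n. ln (Z a n) / real n) \<longlonglongrightarrow> L"
proof -
  obtain N0 where N0: "\<And>n. N0 \<le> n \<Longrightarrow> 0 < Z a n"
    using Z_pos[of a] by (auto simp: eventually_sequentially)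
  define N where "N = max 1 N0"
  have N: "1 \<le> N" "\<And>n. N \<le> n \<Longrightarrow> 0 < Z a n" using N0 by (auto simp: N_def)
  define u where "u n = C + 2 * D - ln (Z a n)" for n
  \<comment> \<open>The base of the exponential bound on \<open>Z\<close>; it must be positive,
    since its powers bound positive values of \<open>Z\<close>.\<close>
  define B where "B = exp C * (\<Sum>i. p i)"
  have sub: "u (n + m) \<le> u n + u m" if nm: "N \<le> n" "N \<le> m" for n m
  proof -
    have pos: "0 < Z a n" "0 < Z a m" "0 < Z a (n + m)" using N(2) nm by auto
    have "ln (Z a n * Z a m) \<le> ln (exp (C + 2 * D) * Z a (n + m))"
      using pos Z_mult_le[of n m a] nm N(1) by (subst ln_le_cancel_iff) auto
    then show ?thesis using pos by (simp add: u_def ln_mult)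
  qed
  let ?I = "INF n\<in>{N..}. ereal (u n / real n)"
  have lim: "(\<lambda>n. ereal (u n / real n)) \<longlonglongrightarrow> ?I"
    by (rule fekete[OF N(1) sub])
  have "?I \<le> ereal (u N / real N)" by (rule INF_lower) simp
  moreover have "ereal (- ln B) \<le> ?I"
  proof (rule INF_greatest)
    fix n assume "n \<in> {N..}"
    then have n: "1 \<le> n" "N \<le> n" using N(1) by auto
    then have le: "Z a n \<le> B ^ n" and pos: "0 < Z a n"
      using Z_le[of n a] N(2) by (auto simp: B_def)
    have "0 \<le> B" unfolding B_def using p(1,2) by (simp add: suminf_nonneg)
    moreover have "B \<noteq> 0" using le pos n by (cases "B = 0") (auto simp: power_0_left)
    ultimately have "0 < B" by simp
    then have "ln (Z a n) \<le> real n * ln B"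
      using ln_mono[OF le pos] by (simp add: ln_realpow)
    moreover have "- ln (Z a n) \<le> u n" using C_nonneg D_nonneg by (simp add: u_def)
    ultimately have "real n * (- ln B) \<le> u n" by simp
    then show "ereal (- ln B) \<le> ereal (u n / real n)"
      using n by (simp add: field_simps)
  qed
  ultimately obtain L where "?I = ereal L"
    by (cases ?I) auto
  with lim have "(\<lambda>n. u n / real n) \<longlonglongrightarrow> L" by simp
  then have "(\<lambda>n. (C + 2 * D) / real n - u n / real n) \<longlonglongrightarrow> 0 - L"
    by (intro tendsto_intros lim_const_over_n)
  then have "(\<lambda>n. ln (Z a n) / real n) \<longlonglongrightarrow> - L"
    by (simp add: u_def diff_divide_distrib[symmetric])
  then show ?thesis by (rule that)
qed

text \<open>A fixed shift of the index leaves exponential growth rates unchanged. This absorbs the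
  connecting blocks of length \<open>l\<close>.\<close>

lemma growth_rate_le:
  fixes u :: "nat \<Rightarrow> real"
  assumes a: "(\<lambda>n. ln (Z a n) / real n) \<longlonglongrightarrow> La" and u: "(\<lambda>n. u n / real n) \<longlonglongrightarrow> Lu"
    and le: "eventually (\<lambda>n. u n \<le> ln (Z a (n + l))) sequentially"
  shows "Lu \<le> La"
proof (rule LIMSEQ_le)
  show "(\<lambda>n. ln (Z a (n + l)) / real (n + l)) \<longlonglongrightarrow> La"
    using LIMSEQ_ignore_initial_segment[OF a, of l] by simp
  have "(\<lambda>n. real n / real (n + l)) \<longlonglongrightarrow> 1"
    by real_asymp
  from tendsto_mult[OF u this] have "(\<lambda>n. u n / real n * (real n / real (n + l))) \<longlonglongrightarrow> Lu"
    by simp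
  moreover have "eventually (\<lambda>n. u n / real n * (real n / real (n + l)) = u n / real (n + l)) sequentially"
    by (rule eventually_sequentiallyI[of 1]) simp
  ultimately show "(\<lambda>n. u n / real (n + l)) \<longlonglongrightarrow> Lu"
    by (rule Lim_transform_eventually)
  show "\<exists>N. \<forall>n\<ge>N. u n / real (n + l) \<le> ln (Z a (n + l)) / real (n + l)"
    using le unfolding eventually_sequentially by (meson divide_right_mono of_nat_0_le_iff)
qed

text \<open>Mixing connects any two letters at all sufficiently large lengths, so a finite set of
  letters admits a single length \<open>l\<close> for all connections to and from
  \<open>a\<close>.\<close>

lemma connecting_points:
  assumes B: "finite B"
  obtains l u where "1 \<le> l"
    "\<And>c. c \<in> B \<Longrightarrow> u a c \<in> shift_space M \<and> u a c 0 = a \<and> u a c l = c"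
    "\<And>c. c \<in> B \<Longrightarrow> u c a \<in> shift_space M \<and> u c a 0 = c \<and> u c a l = a"
proof -
  have "eventually (\<lambda>l. 1 \<le> l \<and> (\<forall>c\<in>B. (\<exists>x\<in>shift_space M. x 0 = a \<and> x l = c) \<and>
      (\<exists>x\<in>shift_space M. x 0 = c \<and> x l = a))) sequentially"
    using B by (intro eventually_conj eventually_ge_at_top eventually_ball_finite ballI
        eventually_connecting_point[OF transition mixing])
  then obtain l where l: "1 \<le> l" "\<And>c. c \<in> B \<Longrightarrow> \<exists>x\<in>shift_space M. x 0 = a \<and> x l = c"
      "\<And>c. c \<in> B \<Longrightarrow> \<exists>x\<in>shift_space M. x 0 = c \<and> x l = a"
    using eventually_happens by force
  define u where "u d c = (SOME x. x \<in> shift_space M \<and> x 0 = d \<and> x l = c)" for d c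
  have u: "u d c \<in> shift_space M \<and> u d c 0 = d \<and> u d c l = c"
    if "\<exists>x\<in>shift_space M. x 0 = d \<and> x l = c" for d c
    unfolding u_def using that by (intro someI_ex[of "\<lambda>x. x \<in> shift_space M \<and> x 0 = d \<and> x l = c"]) blast
  show ?thesis using that[of l u] l u by blast
qed

text \<open>The loss \<open>K\<close> and the added length \<open>l\<close> depend on the finite set
  \<open>B\<close> and the letter \<open>a\<close> only, not on \<open>n\<close> or the segment.
  Since \<open>l\<close> is twice the connecting length, the segment starts at
  \<open>l div 2\<close>.\<close>

lemma exists_closing:
  assumes B: "finite B"
  obtains l K where "1 \<le> l"
    "\<And>n x. 1 \<le> n \<Longrightarrow> x \<in> shift_space M \<Longrightarrow> x 0 \<in> B \<Longrightarrow> x n \<in> B \<Longrightarrow>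
      \<exists>z\<in>periodic_points M (n + l) a. f n x - K \<le> f (n + l) z \<and> (\<forall>i<n. z (l div 2 + i) = x i)"
proof -
  obtain k u where k: "1 \<le> k" and u: "\<And>b. b \<in> B \<Longrightarrow> u a b \<in> shift_space M \<and> u a b 0 = a \<and> u a b k = b"
    "\<And>b. b \<in> B \<Longrightarrow> u b a \<in> shift_space M \<and> u b a 0 = b \<and> u b a k = a"
    using connecting_points[OF B, of a] by metis
  \<comment> \<open>The sum over \<open>B\<close> appears twice, once for each of the two connecting
    blocks, whose letters may differ.\<close>
  define K where "K = 2 * C + 3 * D + (\<Sum>b\<in>B. \<bar>f k (u a b)\<bar> + \<bar>f k (u b a)\<bar>) + (\<Sum>b\<in>B. \<bar>f k (u a b)\<bar> + \<bar>f k (u b a)\<bar>)"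
  have S: "\<bar>f k (u a b)\<bar> + \<bar>f k (u b a)\<bar> \<le> (\<Sum>b\<in>B. \<bar>f k (u a b)\<bar> + \<bar>f k (u b a)\<bar>)" if "b \<in> B" for b
    by (rule member_le_sum[OF that]) (auto simp: B)
  have "\<exists>z\<in>periodic_points M (n + 2 * k) a. f n x - K \<le> f (n + 2 * k) z \<and> (\<forall>i<n. z (2 * k div 2 + i) = x i)"
    if n: "1 \<le> n" and x: "x \<in> shift_space M" "x 0 \<in> B" "x n \<in> B" for n x
  proof -
    define z where "z = periodic_extension (k + (n + k)) (splice k (u a (x 0)) (splice n x (u (x n) a)))"
    have idx: "k + (n + k) = n + 2 * k" by simp
    have "z \<in> periodic_points M (k + (n + k)) a"
      "f k (u a (x 0)) + f n x + f k (u (x n) a) - (2 * C + 3 * D) \<le> f (k + (n + k)) z"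
      "\<And>i. i < n \<Longrightarrow> z (k + i) = x i"
      unfolding z_def using close_up[OF n k k _ x(1), of "u a (x 0)" "u (x n) a" a] u(1)[OF x(2)] u(2)[OF x(3)] by simp_all
    moreover have "f n x - K \<le> f k (u a (x 0)) + f n x + f k (u (x n) a) - (2 * C + 3 * D)"
      using S[OF x(2)] S[OF x(3)] unfolding K_def by linarith
    ultimately show ?thesis unfolding idx by (intro bexI[of _ z]) auto
  qed
  then show ?thesis using that[of "2 * k" K] k by simp
qed

text \<open>Loops at \<open>c\<close> are closed up to longer loops at \<open>a\<close>; the map is
  injective because the original block can be read off the result.\<close>

lemma Z_change_letter:
  obtains l K where "\<And>n. 1 \<le> n \<Longrightarrow> Z c n \<le> exp K * Z a (n + l)"
proof -
  obtain l K where l: "1 \<le> l" and close: "\<And>n x. 1 \<le> n \<Longrightarrow> x \<in> shift_space M \<Longrightarrow> x 0 \<in> {c} \<Longrightarrow> x n \<in> {c} \<Longrightarrow>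
      \<exists>z\<in>periodic_points M (n + l) a. f n x - K \<le> f (n + l) z \<and> (\<forall>i<n. z (l div 2 + i) = x i)"
    using exists_closing[of "{c}" a] by blast
  have "Z c n \<le> exp K * Z a (n + l)" if n: "1 \<le> n" for n
    unfolding Z_def[of c]
  proof (rule infsum_le_finite_sums[OF summable_on_periodic_points[OF n]])
    fix F assume F: "finite F" "F \<subseteq> periodic_points M n c"
    have "\<forall>x\<in>F. \<exists>z. z \<in> periodic_points M (n + l) a \<and> f n x - K \<le> f (n + l) z \<and> (\<forall>i<n. z (l div 2 + i) = x i)"
    proof
      fix x assume "x \<in> F"
      with F have "x n = c \<and> x 0 = c \<and> x \<in> shift_space M"
        by (intro periodic_points_return) auto
      then show "\<exists>z. z \<in> periodic_points M (n + l) a \<and> f n x - K \<le> f (n + l) z \<and> (\<forall>i<n. z (l div 2 + i) = x i)"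
        using close[OF n, of x] by blast
    qed
    from bchoice[OF this] obtain \<phi> where \<phi>: "\<forall>x\<in>F. \<phi> x \<in> periodic_points M (n + l) a \<and>
        f n x - K \<le> f (n + l) (\<phi> x) \<and> (\<forall>i<n. \<phi> x (l div 2 + i) = x i)" ..
    have inj: "inj_on \<phi> F"
    proof (rule inj_onI)
      fix x y assume xy: "x \<in> F" "y \<in> F" "\<phi> x = \<phi> y"
      have "x i = y i" if "i < n" for i
        using bspec[OF \<phi> xy(1)] bspec[OF \<phi> xy(2)] xy(3) that by (metis (no_types))
      then show "x = y" using F xy(1,2) n by (intro periodic_points_eqI[of x M n c y c]) auto
    qed
    have "(\<Sum>x\<in>F. exp (f n x)) \<le> (\<Sum>x\<in>F. exp K * exp (f (n + l) (\<phi> x)))"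
      using \<phi> by (intro sum_mono) (fastforce simp: exp_add[symmetric])
    also have "\<dots> = exp K * (\<Sum>z\<in>\<phi> ` F. exp (f (n + l) z))"
      by (simp add: sum.reindex[OF inj] sum_distrib_left)
    also have "\<dots> \<le> exp K * Z a (n + l)"
      using F \<phi> n by (intro mult_left_mono sum_le_Z) auto
    finally show "(\<Sum>x\<in>F. exp (f n x)) \<le> exp K * Z a (n + l)" .
  qed
  then show ?thesis by (rule that)
qed

lemma growth_rate_mono:
  assumes a: "(\<lambda>n. ln (Z a n) / real n) \<longlonglongrightarrow> La" and c: "(\<lambda>n. ln (Z c n) / real n) \<longlonglongrightarrow> Lb"
  shows "Lb \<le> La"
proof -
  obtain l K where lK: "\<And>n. 1 \<le> n \<Longrightarrow> Z c n \<le> exp K * Z a (n + l)"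
    using Z_change_letter by blast
  have "(\<lambda>n. ln (Z c n) / real n - K / real n) \<longlonglongrightarrow> Lb - 0"
    by (intro tendsto_diff c lim_const_over_n)
  then have "(\<lambda>n. (ln (Z c n) - K) / real n) \<longlonglongrightarrow> Lb"
    by (simp add: diff_divide_distrib)
  moreover have "eventually (\<lambda>n. ln (Z c n) - K \<le> ln (Z a (n + l))) sequentially"
    using Z_pos[of c] eventually_ge_at_top[of 1]
  proof eventually_elim
    case (elim n)
    then have "0 < exp K * Z a (n + l)" using lK[of n] by linarith
    then have pos: "0 < Z a (n + l)" by (simp add: zero_less_mult_iff)
    have "ln (Z c n) \<le> ln (exp K * Z a (n + l))"
      using elim lK[of n] by (intro ln_mono) auto
    then show ?case using pos by (simp add: ln_mult)
  qed
  ultimately show ?thesis by (rule growth_rate_le[OF a])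
qed

text \<open>Comparing letters in both directions shows that the limits agree, so the description
  operator in \<open>gurevich_pressure\<close> is well defined and its value is a real
  number.\<close>

lemma gurevich_pressure_LIMSEQ:
  obtains L where "gurevich_pressure M f = ereal L" "\<And>a. (\<lambda>n. ln (Z a n) / real n) \<longlonglongrightarrow> L"
proof -
  obtain L where L: "(\<lambda>n. ln (Z 0 n) / real n) \<longlonglongrightarrow> L" using ln_Z_LIMSEQ .
  have all: "(\<lambda>n. ln (Z a n) / real n) \<longlonglongrightarrow> L" for a
  proof -
    obtain La where La: "(\<lambda>n. ln (Z a n) / real n) \<longlonglongrightarrow> La" using ln_Z_LIMSEQ .
    moreover have "La = L" using growth_rate_mono[OF L La] growth_rate_mono[OF La L] by simp
    ultimately show ?thesis by simp
  qed
  have conv: "(\<lambda>n. ereal (1 / real n) * ext_ln (periodic_sum M f a n)) \<longlonglongrightarrow> ereal L" for a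
  proof (rule Lim_transform_eventually)
    show "(\<lambda>n. ereal (ln (Z a n) / real n)) \<longlonglongrightarrow> ereal L" using all by simp
    show "eventually (\<lambda>n. ereal (ln (Z a n) / real n) = ereal (1 / real n) * ext_ln (periodic_sum M f a n)) sequentially"
      using Z_pos[of a] eventually_ge_at_top[of 1]
      by eventually_elim (auto simp: periodic_sum_eq_Z ext_ln_def)
  qed
  have "gurevich_pressure M f = ereal L"
    unfolding gurevich_pressure_def
    by (rule the_equality) (use conv LIMSEQ_unique in blast)+
  then show ?thesis using all that by blast
qed

text \<open>One good orbit segment per length is enough: after closing up it is a single term of the
  partition function, and that term already grows at rate \<open>\<alpha>\<close>.\<close>

lemma gurevich_pressure_ge:
  assumes B: "finite B"
    and orbit: "\<And>n. 1 \<le> n \<Longrightarrow> \<exists>x\<in>shift_space M. x 0 \<in> B \<and> x n \<in> B \<and> real n * \<alpha> - \<beta> \<le> f n x"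
  shows "ereal \<alpha> \<le> gurevich_pressure M f"
proof -
  obtain L where L: "gurevich_pressure M f = ereal L" "\<And>a. (\<lambda>n. ln (Z a n) / real n) \<longlonglongrightarrow> L"
    using gurevich_pressure_LIMSEQ by blast
  obtain l K where l: "1 \<le> l" and close: "\<And>n x. 1 \<le> n \<Longrightarrow> x \<in> shift_space M \<Longrightarrow> x 0 \<in> B \<Longrightarrow> x n \<in> B \<Longrightarrow>
      \<exists>z\<in>periodic_points M (n + l) 0. f n x - K \<le> f (n + l) z \<and> (\<forall>i<n. z (l div 2 + i) = x i)"
    using exists_closing[OF B, of 0] by blast
  have "(\<lambda>n. \<alpha> - (\<beta> + K) / real n) \<longlonglongrightarrow> \<alpha> - 0"
    by (intro tendsto_intros lim_const_over_n)
  moreover have "eventually (\<lambda>n. \<alpha> - (\<beta> + K) / real n = (real n * \<alpha> - \<beta> - K) / real n) sequentially"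
    by (rule eventually_sequentiallyI[of 1]) (simp add: field_simps)
  ultimately have "(\<lambda>n. (real n * \<alpha> - \<beta> - K) / real n) \<longlonglongrightarrow> \<alpha> - 0"
    by (rule Lim_transform_eventually)
  moreover have "eventually (\<lambda>n. real n * \<alpha> - \<beta> - K \<le> ln (Z 0 (n + l))) sequentially"
  proof (rule eventually_sequentiallyI[of 1])
    fix n :: nat assume n: "1 \<le> n"
    obtain x where x: "x \<in> shift_space M" "x 0 \<in> B" "x n \<in> B" "real n * \<alpha> - \<beta> \<le> f n x"
      using orbit[OF n] by blast
    obtain z where z: "z \<in> periodic_points M (n + l) 0" "f n x - K \<le> f (n + l) z"
      using close[OF n x(1-3)] by blast
    have "exp (f (n + l) z) \<le> Z 0 (n + l)"
      using n by (intro exp_le_Z z) simp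
    then have "ln (exp (f (n + l) z)) \<le> ln (Z 0 (n + l))"
      by (intro ln_mono) auto
    then show "real n * \<alpha> - \<beta> - K \<le> ln (Z 0 (n + l))"
      using x(4) z(2) by simp
  qed
  ultimately have "\<alpha> - 0 \<le> L"
    by (rule growth_rate_le[OF L(2)])
  then show ?thesis by (simp add: L(1))
qed

end

section \<open>Maximising measures\<close>

context aa_potential
begin

text \<open>Weak convergence does not apply to \<open>f n\<close>, which may be unbounded below. It
  is cut off from below, which increases its integrals; the lower bound survives the weak limit, and
  Fatou's lemma removes the cut-off. Integrability of \<open>f 1\<close> under the limit measure is
  a by-product.\<close>

lemma mean_potential_le_of_weak_limit:
  assumes \<nu>: "\<nu> \<in> invariant_measures M" and \<mu>: "\<And>k. \<mu> k \<in> invariant_measures M"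
    and weak: "weakly_converges M \<mu> \<nu>"
    and int: "\<And>k. integrable (\<mu> k) (f 1)"
    and A: "\<And>k. mean_potential f (\<mu> k) = ereal (A k)" "A \<longlonglongrightarrow> S"
  shows "ereal S \<le> mean_potential f \<nu>"
proof -
  interpret \<nu>: invariant_shift_measure \<nu> M by (rule invariant_shift_measureI[OF \<nu>])
  have mean: "\<bar>(\<integral>x. f n x \<partial>\<mu> k) - real n * A k\<bar> \<le> C" if "1 \<le> n" for n k
    using mean_potential_integrable[OF \<mu> int, of k] A(1)[of k] that by (metis ereal.inject)
  have main: "integrable \<nu> (f n) \<and> real n * S - C \<le> (\<integral>x. f n x \<partial>\<nu>)" if n: "1 \<le> n" for n
  proof -
    let ?c = "real n * (b + C)"
    \<comment> \<open>The absolute value of \<open>?c\<close> keeps the cut-off level below the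
      upper bound \<open>?c\<close>, so \<open>g r\<close> has the same upper bound as
      \<open>f n\<close>.\<close>
    define g where "g r x = max (f n x) (- (\<bar>?c\<bar> + real r))" for r x
    have fc: "f n x \<le> ?c" if "x \<in> shift_space M" for x by (rule potential_le[OF n that])
    have g: "- (\<bar>?c\<bar> + real r) \<le> g r x" "g r x \<le> \<bar>?c\<bar>" "f n x \<le> g r x" "g r x \<le> ?c" if "x \<in> shift_space M" for r x
      using fc[OF that] by (auto simp: g_def)
    have gabs: "\<bar>g r x\<bar> \<le> \<bar>?c\<bar> + real r" if "x \<in> shift_space M" for r x
      using g(1,2)[OF that, of r] by linarith
    have cont: "continuous_map (shift_topology M) euclideanreal (g r)" for r
      unfolding g_def using continuous n
      by (intro continuous_map_real_max continuous_map_const[THEN iffD2]) (auto simp: continuous_potential_def)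
    have bdd: "bounded (g r ` shift_space M)" for r
      unfolding bounded_iff using gabs[of _ r] by (auto intro!: exI[of _ "\<bar>?c\<bar> + real r"])
    have intg: "integrable m (g r)" if m: "m \<in> invariant_measures M" for m r
    proof -
      interpret m: invariant_shift_measure m M by (rule invariant_shift_measureI[OF m])
      show ?thesis
        using continuous_borel_measurable[OF cont] gabs
        by (intro m.integrable_const_bound[where B = "\<bar>?c\<bar> + real r"] AE_I2)
           (auto simp: m.space_eq cong: measurable_cong_sets[OF m.sets_eq refl])
    qed
    have lower: "real n * S - C \<le> (\<integral>x. g r x \<partial>\<nu>)" for r
    proof (rule LIMSEQ_le)
      show "(\<lambda>k. real n * A k - C) \<longlonglongrightarrow> real n * S - C"
        by (intro tendsto_intros A(2))
      show "(\<lambda>k. \<integral>x. g r x \<partial>\<mu> k) \<longlonglongrightarrow> (\<integral>x. g r x \<partial>\<nu>)"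
        using weak cont bdd unfolding weakly_converges_def by blast
      have "real n * A k - C \<le> (\<integral>x. g r x \<partial>\<mu> k)" for k
      proof -
        interpret m: invariant_shift_measure "\<mu> k" M by (rule invariant_shift_measureI[OF \<mu>])
        have "(\<integral>x. f n x \<partial>\<mu> k) \<le> (\<integral>x. g r x \<partial>\<mu> k)"
          using integrable_potential_iff[OF \<mu> n] int intg[OF \<mu>] g(3)
          by (intro integral_mono) (auto simp: m.space_eq)
        then show ?thesis using mean[OF n, of k] by linarith
      qed
      then show "\<exists>N. \<forall>k\<ge>N. real n * A k - C \<le> (\<integral>x. g r x \<partial>\<mu> k)" by blast
    qed
    have gm: "g r \<in> borel_measurable \<nu>" for r
      using borel_measurable_integrable[OF intg[OF \<nu>]] .
    \<comment> \<open>Subtracting from the upper bound makes the functions nonnegative; at each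
      point the cut-off is inactive once \<open>r\<close> is large.\<close>
    have "(\<integral>\<^sup>+x. ennreal (?c - f n x) \<partial>\<nu>) = (\<integral>\<^sup>+x. liminf (\<lambda>r. ennreal (?c - g r x)) \<partial>\<nu>)"
    proof (rule nn_integral_cong)
      fix x
      have "eventually (\<lambda>r. ennreal (?c - g r x) = ennreal (?c - f n x)) sequentially"
      proof (rule eventually_sequentiallyI)
        fix r assume "nat \<lceil>\<bar>f n x\<bar>\<rceil> \<le> r"
        then have "\<bar>f n x\<bar> \<le> real r" by linarith
        then show "ennreal (?c - g r x) = ennreal (?c - f n x)" by (simp add: g_def)
      qed
      then have "(\<lambda>r. ennreal (?c - g r x)) \<longlonglongrightarrow> ennreal (?c - f n x)"
        by (rule tendsto_eventually)
      then show "ennreal (?c - f n x) = liminf (\<lambda>r. ennreal (?c - g r x))"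
        by (intro lim_imp_Liminf[symmetric]) auto
    qed
    also have "\<dots> \<le> liminf (\<lambda>r. \<integral>\<^sup>+x. ennreal (?c - g r x) \<partial>\<nu>)"
      using gm by (intro nn_integral_liminf) auto
    also have "\<dots> \<le> ennreal (?c - (real n * S - C))"
    proof (intro Liminf_le always_eventually allI)
      fix r
      have "(\<integral>\<^sup>+x. ennreal (?c - g r x) \<partial>\<nu>) = ennreal (\<integral>x. ?c - g r x \<partial>\<nu>)"
        using intg[OF \<nu>] g(4) by (intro nn_integral_eq_integral) (auto simp: \<nu>.space_eq)
      also have "\<dots> \<le> ennreal (?c - (real n * S - C))"
        using lower[of r] intg[OF \<nu>, of r] by (intro ennreal_leI) (simp add: \<nu>.prob_space)
      finally show "(\<integral>\<^sup>+x. ennreal (?c - g r x) \<partial>\<nu>) \<le> ennreal (?c - (real n * S - C))" .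
    qed simp
    finally have le: "(\<integral>\<^sup>+x. ennreal (?c - f n x) \<partial>\<nu>) \<le> ennreal (?c - (real n * S - C))" .
    have fm: "f n \<in> borel_measurable \<nu>" by (rule potential_borel_measurable[OF \<nu> n])
    have nonneg: "AE x in \<nu>. 0 \<le> ?c - f n x"
      using fc by (intro AE_I2) (auto simp: \<nu>.space_eq)
    have int1: "integrable \<nu> (\<lambda>x. ?c - f n x)"
      using le fm nonneg by (intro integrableI_nonneg) (auto intro: order.strict_trans1)
    then have int2: "integrable \<nu> (f n)"
      using Bochner_Integration.integrable_diff[OF \<nu>.integrable_const[of ?c] int1] by simp
    \<comment> \<open>\<open>ennreal\<close> sends negative numbers to 0, so the bound must be known
      to be nonnegative before the inequality returns to the reals.\<close>
    have "0 \<le> (\<integral>x. ?c - g 0 x \<partial>\<nu>)"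
      using g(4) by (intro integral_nonneg_AE AE_I2) (auto simp: \<nu>.space_eq)
    then have "0 \<le> ?c - (real n * S - C)"
      using lower[of 0] intg[OF \<nu>, of 0] by (simp add: \<nu>.prob_space)
    then have "(\<integral>x. ?c - f n x \<partial>\<nu>) \<le> ?c - (real n * S - C)"
      using le unfolding nn_integral_eq_integral[OF int1 nonneg] by (simp only: ennreal_le_iff)
    then show ?thesis using int2 by (simp add: \<nu>.prob_space)
  qed
  have "integrable \<nu> (f 1)" using main[of 1] by simp
  then obtain A' where A': "mean_potential f \<nu> = ereal A'"
    "\<And>n. 1 \<le> n \<Longrightarrow> \<bar>(\<integral>x. f n x \<partial>\<nu>) - real n * A'\<bar> \<le> C"
    using mean_potential_integrable[OF \<nu>] by blast
  have "S - A' \<le> 0"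
  proof (rule LIMSEQ_le_const)
    show "(\<lambda>n. 2 * C / real n) \<longlonglongrightarrow> 0" by (rule lim_const_over_n)
    \<comment> \<open>One \<open>C\<close> comes from the approximating measures, the other from the
      limit measure. Both are independent of \<open>n\<close>, so dividing by \<open>n\<close>
      removes them.\<close>
    have "S - A' \<le> 2 * C / real n" if n: "1 \<le> n" for n
    proof -
      have "real n * (S - A') \<le> 2 * C"
        using main[OF n] A'(2)[OF n] by (simp add: algebra_simps abs_le_iff)
      then show ?thesis using n by (simp add: field_simps)
    qed
    then show "\<exists>N. \<forall>n\<ge>N. S - A' \<le> 2 * C / real n" by blast
  qed
  then show ?thesis by (simp add: A'(1))
qed

end

section \<open>Entropy and pressure bounds for the scaled potentials\<close>

context summable_aa_potential
begin

text \<open>Summability survives because \<open>t * f 1 x = f 1 x + (t - 1) * f 1 x\<close> and the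
  last term is at most \<open>(t - 1) * b\<close>.\<close>

lemma scale_summable_aa_potential:
  assumes t: "1 < t"
  shows "summable_aa_potential M (scale_potential t f) (t * C) (t * b) (t * D) (\<lambda>i. exp ((t - 1) * b) * p i)"
proof
  show "continuous_potential M (scale_potential t f)"
    using continuous unfolding continuous_potential_def scale_potential_def
    by (auto intro!: continuous_map_real_mult_left)
  show "0 \<le> t * C" "0 \<le> t * D" using t C_nonneg D_nonneg by auto
  show "transition_matrix M" "topologically_mixing M" by (rule transition mixing)+
  fix n m :: nat and x assume nmx: "1 \<le> n" "1 \<le> m" "x \<in> shift_space M"
  have "t * (f n x + f m ((shift ^^ n) x) - C) \<le> t * f (n + m) x"
    using lower_additive[OF nmx] t by (intro mult_left_mono) auto
  then show "scale_potential t f n x + scale_potential t f m ((shift ^^ n) x) - t * C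
      \<le> scale_potential t f (n + m) x" by (simp add: scale_potential_def algebra_simps)
  have "t * f (n + m) x \<le> t * (f n x + f m ((shift ^^ n) x) + C)"
    using upper_additive[OF nmx] t by (intro mult_left_mono) auto
  then show "scale_potential t f (n + m) x \<le> scale_potential t f n x + scale_potential t f m ((shift ^^ n) x) + t * C"
    by (simp add: scale_potential_def algebra_simps)
next
  fix x assume x: "x \<in> shift_space M"
  show "scale_potential t f 1 x \<le> t * b"
    using bounded_above[OF x] t by (simp add: scale_potential_def)
  have "(t - 1) * f 1 x \<le> (t - 1) * b"
    using bounded_above[OF x] t by (intro mult_left_mono) auto
  then have "exp (scale_potential t f 1 x) \<le> exp ((t - 1) * b) * exp (f 1 x)"
    by (simp add: scale_potential_def exp_add[symmetric] algebra_simps)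
  also have "\<dots> \<le> exp ((t - 1) * b) * p (x 0)"
    using p(3)[OF x] by (intro mult_left_mono) auto
  finally show "exp (scale_potential t f 1 x) \<le> exp ((t - 1) * b) * p (x 0)" .
next
  fix n :: nat and x y assume "1 \<le> n" "x \<in> shift_space M" "y \<in> shift_space M" "\<And>i. i < n \<Longrightarrow> x i = y i"
  then have "\<bar>f n x - f n y\<bar> \<le> D" by (rule variation)
  then have "t * \<bar>f n x - f n y\<bar> \<le> t * D" using t by (intro mult_left_mono) auto
  then show "\<bar>scale_potential t f n x - scale_potential t f n y\<bar> \<le> t * D"
    using t by (simp add: scale_potential_def abs_mult right_diff_distrib[symmetric])
next
  show "summable (\<lambda>i. exp ((t - 1) * b) * p i)" using p(2) by (rule summable_mult)
qed (use p(1) in auto)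

text \<open>The coding bound with the normalised weights \<open>p\<close>: their logarithm dominates
  \<open>f 1\<close> up to the constant \<open>ln ?Z\<close>.\<close>

lemma KS_entropy_le_integral:
  assumes \<nu>: "\<nu> \<in> invariant_measures M" and f1: "integrable \<nu> (f 1)"
  shows "KS_entropy \<nu> shift \<le> ereal (ln 2 + 1 + ln (\<Sum>i. p i) - (\<integral>x. f 1 x \<partial>\<nu>))"
proof -
  interpret invariant_shift_measure \<nu> M by (rule invariant_shift_measureI[OF \<nu>])
  \<comment> \<open>Every letter starts some point, which forces its weight to be positive;
    otherwise the logarithm below would be meaningless.\<close>
  have ppos: "0 < p i" for i
  proof -
    obtain q where "q \<in> shift_space M" "q 0 = i" using exists_point_from_letter[OF transition] .
    then show ?thesis using p(3)[of q] exp_gt_zero[of "f 1 q"] by (simp del: exp_gt_zero)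
  qed
  let ?Z = "\<Sum>i. p i"
  have pZ: "p i \<le> ?Z" for i
    using sum_le_suminf[OF p(2), of "{i}"] p(1) by simp
  have Z: "0 < ?Z" using ppos[of 0] pZ[of 0] by linarith
  \<comment> \<open>Normalisation makes the weights \<open>exp (s i)\<close> sum to 1. Being
    squeezed between \<open>f 1 x - ln ?Z\<close> and 0, \<open>s (x 0)\<close> is
    integrable.\<close>
  define s where "s i = ln (p i) - ln ?Z" for i
  have s0: "s i \<le> 0" for i using pZ ppos Z by (simp add: s_def)
  have sf: "f 1 x - ln ?Z \<le> s (x 0)" if "x \<in> shift_space M" for x
    using ln_mono[OF p(3)[OF that]] by (simp add: s_def)
  have int: "integrable \<nu> (\<lambda>x. s (x 0))"
  proof (rule Bochner_Integration.integrable_bound)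
    show "integrable \<nu> (\<lambda>x. \<bar>f 1 x\<bar> + \<bar>ln ?Z\<bar>)" using f1 by simp
    show "(\<lambda>x. s (x 0)) \<in> borel_measurable \<nu>"
      using measurable_compose[OF coordinate_measurable[of 0], of s borel] by simp
    show "AE x in \<nu>. norm (s (x 0)) \<le> norm (\<bar>f 1 x\<bar> + \<bar>ln ?Z\<bar>)"
    proof (rule AE_I2)
      fix x assume "x \<in> space \<nu>"
      then show "norm (s (x 0)) \<le> norm (\<bar>f 1 x\<bar> + \<bar>ln ?Z\<bar>)"
        using sf[of x] s0[of "x 0"] unfolding real_norm_def space_eq by linarith
    qed
  qed
  have "(\<integral>\<^sup>+i. ennreal (exp (s i)) \<partial>count_space UNIV) = (\<Sum>i. ennreal (p i / ?Z))"
    using ppos Z by (simp add: nn_integral_count_space_nat s_def exp_diff)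
  also have "\<dots> = ennreal (\<Sum>i. p i / ?Z)"
    using p Z by (intro suminf_ennreal2) (auto intro: summable_divide)
  also have "(\<Sum>i. p i / ?Z) = 1"
    using suminf_divide[OF p(2), of ?Z] Z by simp
  finally have s1: "(\<integral>\<^sup>+i. ennreal (exp (s i)) \<partial>count_space UNIV) \<le> 1" by simp
  have "(\<integral>x. f 1 x - ln ?Z \<partial>\<nu>) \<le> (\<integral>x. s (x 0) \<partial>\<nu>)"
    using f1 int sf by (intro integral_mono) (auto simp: space_eq)
  then have "ln 2 + 1 - (\<integral>x. s (x 0) \<partial>\<nu>) \<le> ln 2 + 1 + ln ?Z - (\<integral>x. f 1 x \<partial>\<nu>)"
    using f1 by (simp add: prob_space)
  with KS_entropy_le[OF int s1] show ?thesis
    by (meson ereal_less_eq(3) order_trans)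
qed

text \<open>Letters at times 0 and \<open>n\<close> are below \<open>r\<close> outside a set of
  measure at most \<open>2 * \<delta>\<close>, with \<open>r\<close> independent of \<open>n\<close>
  by invariance. If \<open>f n\<close> were small on all the good points, the upper bound
  \<open>n * (b + C)\<close> on the remaining ones could not restore the integral. The slope in the
  bound tends to \<open>A\<close> as \<open>\<delta>\<close> tends to 0.\<close>

lemma exists_orbit_segment:
  assumes \<nu>: "\<nu> \<in> invariant_measures M" and f1: "integrable \<nu> (f 1)"
    and A: "mean_potential f \<nu> = ereal A" and \<delta>: "0 < \<delta>" "\<delta> < 1 / 2"
  obtains r where "\<And>n. 1 \<le> n \<Longrightarrow> \<exists>x\<in>shift_space M. x 0 < r \<and> x n < r \<and>
      real n * (b + C + (A - (b + C)) / (1 - 2 * \<delta>)) - (C / (1 - 2 * \<delta>) + 1) \<le> f n x"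
proof -
  interpret invariant_shift_measure \<nu> M by (rule invariant_shift_measureI[OF \<nu>])
  have letter: "{x \<in> shift_space M. x i \<in> S} \<in> sets \<nu>" for i S
    by (rule depends_on_prefix_pred[of "Suc i"]) (auto simp: depends_on_prefix_def)
  let ?T = "\<lambda>r i. {x \<in> shift_space M. x i \<in> {r..}}"
  have "range (\<lambda>r. ?T r 0) \<subseteq> sets \<nu>" using letter by blast
  then have "(\<lambda>r. prob (?T r 0)) \<longlonglongrightarrow> prob (\<Inter>r. ?T r 0)"
    by (intro finite_Lim_measure_decseq) (auto simp: decseq_def)
  moreover have "(\<Inter>r. ?T r 0) = {}"
    using Suc_n_not_le_n by blast
  ultimately have "eventually (\<lambda>r. prob (?T r 0) < \<delta>) sequentially"
    using \<delta> by (intro order_tendstoD) auto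
  then obtain r where r: "prob (?T r 0) < \<delta>" using eventually_happens by force
  have "\<exists>x\<in>shift_space M. x 0 < r \<and> x n < r \<and>
      real n * (b + C + (A - (b + C)) / (1 - 2 * \<delta>)) - (C / (1 - 2 * \<delta>) + 1) \<le> f n x" if n: "1 \<le> n" for n
  proof (rule ccontr)
    assume neg: "\<not> ?thesis"
    let ?c = "b + C" and ?d = "1 - 2 * \<delta>"
    let ?G = "{x \<in> shift_space M. x 0 < r \<and> x n < r}"
    have d: "0 < ?d" using \<delta> by simp
    have fn: "integrable \<nu> (f n)" using integrable_potential_iff[OF \<nu> n] f1 by simp
    obtain A' where "mean_potential f \<nu> = ereal A'" "\<bar>(\<integral>x. f n x \<partial>\<nu>) - real n * A'\<bar> \<le> C"
      using mean_potential_integrable[OF \<nu> f1] n by metis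
    with A have In: "real n * A - C \<le> (\<integral>x. f n x \<partial>\<nu>)" by (simp add: abs_le_iff)
    have "{x \<in> shift_space M. x 0 < r} \<in> sets \<nu>" "{x \<in> shift_space M. x n < r} \<in> sets \<nu>"
      using letter[of 0 "{..<r}"] letter[of n "{..<r}"] by auto
    moreover have "?G = {x \<in> shift_space M. x 0 < r} \<inter> {x \<in> shift_space M. x n < r}" by auto
    ultimately have G: "?G \<in> sets \<nu>" by auto
    have "(shift ^^ n) -` ?T r 0 \<inter> space \<nu> = ?T r n"
      by (auto simp: space_eq shift_funpow shift_space_def)
    then have Tn: "prob (?T r n) = prob (?T r 0)"
      using prob_funpow[OF letter[of 0 "{r..}"], of n] by simp
    have "1 = prob (space \<nu>)" by (simp add: prob_space)
    also have "\<dots> \<le> prob (?G \<union> (?T r 0 \<union> ?T r n))"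
      using G letter[of 0 "{r..}"] letter[of n "{r..}"]
      by (intro finite_measure_mono sets.Un) (auto simp: space_eq)
    also have "\<dots> \<le> prob ?G + (prob (?T r 0) + prob (?T r n))"
      using G letter[of 0 "{r..}"] letter[of n "{r..}"] by (meson add_left_mono measure_Un_le order_trans sets.Un)
    finally have PG: "?d \<le> prob ?G" using r Tn by linarith
    \<comment> \<open>The mean of \<open>f n\<close> falls short of \<open>n * ?c\<close> by at most
      \<open>n * (?c - A) + C\<close>. A shortfall of \<open>v\<close> on a set of measure
      \<open>?d\<close> alone accounts for all of this, so the \<open>v + 1\<close> assumed for
      contradiction is too much.\<close>
    define v where "v = (real n * (?c - A) + C) / ?d"
    have "v * ?d = real n * (?c - A) + C"
      by (rule nonzero_eq_divide_eq[THEN iffD1, OF _ v_def]) (use d in simp)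
    then have vd: "v * ?d = real n * ?c - real n * A + C" by (simp only: right_diff_distrib)
    have "(\<integral>x. f n x - real n * ?c \<partial>\<nu>) = (\<integral>x. f n x \<partial>\<nu>) - real n * ?c"
      using fn by (simp add: prob_space)
    then have lower: "- (v * ?d) \<le> (\<integral>x. f n x - real n * ?c \<partial>\<nu>)"
      using In unfolding vd by linarith
    have "(\<integral>x. f n x \<partial>\<nu>) \<le> (\<integral>x. real n * ?c \<partial>\<nu>)"
      using fn potential_le[OF n] by (intro integral_mono) (auto simp: space_eq)
    then have "real n * A - C \<le> real n * ?c" using In by (simp add: prob_space)
    then have v0: "0 \<le> v" using d unfolding v_def by (intro divide_nonneg_pos) (auto simp: algebra_simps)
    have "(\<integral>x. f n x - real n * ?c \<partial>\<nu>) \<le> (\<integral>x. - (v + 1) * indicator ?G x \<partial>\<nu>)"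
    proof (rule integral_mono)
      fix x assume "x \<in> space \<nu>"
      then have x: "x \<in> shift_space M" by (simp add: space_eq)
      show "f n x - real n * ?c \<le> - (v + 1) * indicator ?G x"
      proof (cases "x \<in> ?G")
        case True
        then have "f n x < real n * (?c + (A - ?c) / ?d) - (C / ?d + 1)" using neg by force
        also have "\<dots> = real n * ?c - (v + 1)"
        proof -
          have alg: "k * (c + (A - c) / d) - (C / d + 1) = k * c - ((k * (c - A) + C) / d + 1)"
            if "d \<noteq> 0" for k c d :: real
            using that by (simp add: field_simps)
          show ?thesis unfolding v_def by (rule alg) (use d in simp)
        qed
        finally show ?thesis using True by simp
      qed (use potential_le[OF n x] in simp)
    qed (use fn G in \<open>auto simp: emeasure_eq_measure\<close>)
    also have "\<dots> = - (v + 1) * prob ?G" using G by (simp add: emeasure_eq_measure)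
    also have "\<dots> \<le> - (v + 1) * ?d"
      using PG v0 mult_left_mono[of ?d "prob ?G" "v + 1"] by simp
    also have "\<dots> = - (v * ?d) - ?d" by algebra
    also have "\<dots> < - (v * ?d)" using d by linarith
    finally show False using lower by simp
  qed
  then show ?thesis by (rule that)
qed

text \<open>The half of the variational principle without the entropy term.\<close>

lemma mean_potential_le_gurevich_pressure:
  assumes t: "1 < t" and \<nu>: "\<nu> \<in> invariant_measures M" and f1: "integrable \<nu> (f 1)"
    and A: "mean_potential f \<nu> = ereal A"
  shows "ereal (t * A) \<le> gurevich_pressure M (scale_potential t f)"
proof -
  interpret t: summable_aa_potential M "scale_potential t f" "t * C" "t * b" "t * D" "\<lambda>i. exp ((t - 1) * b) * p i"
    by (rule scale_summable_aa_potential[OF t])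
  let ?\<alpha> = "\<lambda>\<delta>. b + C + (A - (b + C)) / (1 - 2 * \<delta>)"
  have le: "ereal (t * ?\<alpha> \<delta>) \<le> gurevich_pressure M (scale_potential t f)" if \<delta>: "0 < \<delta>" "\<delta> < 1 / 2" for \<delta>
  proof -
    obtain r where r: "\<And>n. 1 \<le> n \<Longrightarrow> \<exists>x\<in>shift_space M. x 0 < r \<and> x n < r \<and>
        real n * ?\<alpha> \<delta> - (C / (1 - 2 * \<delta>) + 1) \<le> f n x"
      using exists_orbit_segment[OF \<nu> f1 A \<delta>] by blast
    show ?thesis
    proof (rule t.gurevich_pressure_ge[where B = "{..<r}" and \<beta> = "t * (C / (1 - 2 * \<delta>) + 1)"])
      fix n :: nat assume "1 \<le> n"
      then obtain x where x: "x \<in> shift_space M" "x 0 < r" "x n < r"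
          "real n * ?\<alpha> \<delta> - (C / (1 - 2 * \<delta>) + 1) \<le> f n x"
        using r by blast
      have "t * (real n * ?\<alpha> \<delta> - (C / (1 - 2 * \<delta>) + 1)) \<le> t * f n x"
        using x(4) t by (intro mult_left_mono) auto
      moreover have "t * (real n * ?\<alpha> \<delta> - (C / (1 - 2 * \<delta>) + 1))
          = real n * (t * ?\<alpha> \<delta>) - t * (C / (1 - 2 * \<delta>) + 1)" by (simp only: algebra_simps)
      ultimately show "\<exists>x\<in>shift_space M. x 0 \<in> {..<r} \<and> x n \<in> {..<r} \<and>
          real n * (t * ?\<alpha> \<delta>) - t * (C / (1 - 2 * \<delta>) + 1) \<le> scale_potential t f n x"
        using x(1-3) by (intro bexI[of _ x]) (auto simp: scale_potential_def)
    qed simp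
  qed
  \<comment> \<open>The set of letters and the additive loss depend on \<open>\<delta>\<close>, but
    both have dropped out of \<open>le\<close>, so \<open>\<delta>\<close> may tend to 0; and
    \<open>?\<alpha> 0 = A\<close>.\<close>
  have "((\<lambda>\<delta>. ereal (t * ?\<alpha> \<delta>)) \<longlongrightarrow> ereal (t * ?\<alpha> 0)) (at_right 0)"
    by (intro tendsto_intros) auto
  moreover have "eventually (\<lambda>\<delta>. ereal (t * ?\<alpha> \<delta>) \<le> gurevich_pressure M (scale_potential t f)) (at_right 0)"
    unfolding eventually_at_right_field using le by (intro exI[of _ "1 / 2"]) auto
  ultimately have "ereal (t * ?\<alpha> 0) \<le> gurevich_pressure M (scale_potential t f)"
    by (intro tendsto_upperbound) auto
  then show ?thesis by simp
qed

end

section \<open>Constants from the hypotheses, and the theorem\<close>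

lemma summable_aa_potentialI:
  assumes tm: "transition_matrix M" and "topologically_mixing M" and "continuous_potential M f"
    and aa: "almost_additive M f" and sp: "summable_potential M f" and bv: "bounded_variation M f"
  obtains C b D p where "summable_aa_potential M f C b D p"
proof -
  obtain C where C: "0 \<le> C" "\<And>n m x. 1 \<le> n \<Longrightarrow> 1 \<le> m \<Longrightarrow> x \<in> shift_space M \<Longrightarrow>
      f n x + f m ((shift ^^ n) x) - C \<le> f (n + m) x \<and> f (n + m) x \<le> f n x + f m ((shift ^^ n) x) + C"
    using aa unfolding almost_additive_def by blast
  obtain D where D: "0 \<le> D" "\<And>n x y. 1 \<le> n \<Longrightarrow> x \<in> shift_space M \<Longrightarrow> y \<in> shift_space M \<Longrightarrow>
      (\<forall>i<n. x i = y i) \<Longrightarrow> \<bar>f n x - f n y\<bar> \<le> D"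
    using bv unfolding bounded_variation_def by blast
  define p where "p = (\<lambda>i. exp (SUP x\<in>cylinder M [i]. f 1 x))"
  have bdd: "bdd_above (f 1 ` cylinder M [i])" for i
    using sp by (auto simp: summable_potential_def)
  have p: "summable p" using sp by (simp add: summable_potential_def p_def)
  have fp: "exp (f 1 x) \<le> p (x 0)" if x: "x \<in> shift_space M" for x
    unfolding p_def exp_le_cancel_iff by (rule cSUP_upper[OF _ bdd]) (simp add: cylinder_def x)
  have pb: "p i \<le> (\<Sum>i. p i)" for i
    using sum_le_suminf[OF p, of "{i}"] by (simp add: p_def)
  \<comment> \<open>The upper bound for \<open>f 1\<close> comes from summability: each term of the
    convergent series is at most its sum.\<close>
  have "summable_aa_potential M f C (ln (\<Sum>i. p i)) D p"
  proof
    fix x assume x: "x \<in> shift_space M"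
    have "exp (f 1 x) \<le> (\<Sum>i. p i)" using fp[OF x] pb order_trans by blast
    from ln_mono[OF this] show "f 1 x \<le> ln (\<Sum>i. p i)" by simp
  qed (use assms C D p fp in \<open>auto simp: p_def\<close>)
  then show ?thesis by (rule that)
qed

theorem theorem1p3:
  fixes M :: "nat \<Rightarrow> nat \<Rightarrow> nat"
    and f :: potential
    and \<mu> :: "real \<Rightarrow> (nat \<Rightarrow> nat) measure"
    and \<mu>_inf :: "(nat \<Rightarrow> nat) measure"
  assumes "transition_matrix M"
    and "topologically_mixing M"
    and "continuous_potential M f"
    and "almost_additive M f"
    and "summable_potential M f"
    and "bounded_variation M f"
    and "\<And>t. t > 1 \<Longrightarrow> equilibrium_state M f t (\<mu> t)"
    and "accumulation_point_at_top M \<mu> \<mu>_inf"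
  shows "((\<lambda>t. mean_potential f (\<mu> t)) \<longlongrightarrow> mean_potential f \<mu>_inf) at_top \<and>
         mean_potential f \<mu>_inf = (SUP \<nu>\<in>invariant_measures M. mean_potential f \<nu>) \<and>
         maximising_measure M f \<mu>_inf"
proof -
  obtain C b D p where "summable_aa_potential M f C b D p"
    using summable_aa_potentialI[OF assms(1-6)] .
  then interpret summable_aa_potential M f C b D p .
  let ?S = "SUP \<nu>\<in>invariant_measures M. mean_potential f \<nu>"
  \<comment> \<open>The constant of the entropy bound, with \<open>C\<close> added for replacing the
    integral of \<open>f 1\<close> by the mean.\<close>
  let ?K = "ln 2 + 1 + ln (\<Sum>i. p i) + C"
  define A where "A t = real_of_ereal (mean_potential f (\<mu> t))" for t
  have inv: "\<mu> t \<in> invariant_measures M" if "1 < t" for t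
    using assms(7)[OF that] by (simp add: equilibrium_state_def)
  \<comment> \<open>An equilibrium state has mean above minus infinity by definition, and a
    non-integrable \<open>f 1\<close> would make the mean minus infinity.\<close>
  have int: "integrable (\<mu> t) (f 1)" if t: "1 < t" for t
    using assms(7)[OF t] mean_potential_eq_MInf[OF inv[OF t]] by (force simp: equilibrium_state_def)
  have mean: "mean_potential f (\<mu> t) = ereal (A t)" if t: "1 < t" for t
    using mean_potential_integrable[OF inv[OF t] int[OF t]] unfolding A_def by (metis real_of_ereal.simps(1))
  have pressure: "mean_potential f \<nu> \<le> ereal ((?K + (t - 1) * A t) / t)"
    if t: "1 < t" and \<nu>: "\<nu> \<in> invariant_measures M" for t \<nu>
  proof (cases "integrable \<nu> (f 1)")
    case False
    then show ?thesis using mean_potential_eq_MInf[OF \<nu>] by simp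
  next
    case True
    then obtain B where B: "mean_potential f \<nu> = ereal B"
      using mean_potential_integrable[OF \<nu>] by blast
    obtain A' where "mean_potential f (\<mu> t) = ereal A'" "\<bar>(\<integral>x. f 1 x \<partial>\<mu> t) - real 1 * A'\<bar> \<le> C"
      using mean_potential_integrable[OF inv[OF t] int[OF t]] by (metis order_refl)
    then have I1: "A t - C \<le> (\<integral>x. f 1 x \<partial>\<mu> t)" using mean[OF t] by (simp add: abs_le_iff)
    have "ereal (t * B) \<le> gurevich_pressure M (scale_potential t f)"
      by (rule mean_potential_le_gurevich_pressure[OF t \<nu> True B])
    also have "\<dots> = KS_entropy (\<mu> t) shift + ereal t * ereal (A t)"
      using assms(7)[OF t] by (simp add: equilibrium_state_def mean[OF t])
    also have "\<dots> \<le> ereal (?K - A t) + ereal t * ereal (A t)"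
    proof (rule add_right_mono)
      have "KS_entropy (\<mu> t) shift \<le> ereal (ln 2 + 1 + ln (\<Sum>i. p i) - (\<integral>x. f 1 x \<partial>\<mu> t))"
        by (rule KS_entropy_le_integral[OF inv[OF t] int[OF t]])
      also have "\<dots> \<le> ereal (?K - A t)" using I1 by simp
      finally show "KS_entropy (\<mu> t) shift \<le> ereal (?K - A t)" .
    qed
    finally have "t * B \<le> ?K + (t - 1) * A t" by (simp add: algebra_simps)
    then show ?thesis using t by (simp add: B field_simps)
  qed
  have S_le: "?S \<le> ereal ((?K + (t - 1) * A t) / t)" if "1 < t" for t
    by (intro SUP_least pressure that)
  have le_S: "mean_potential f \<nu> \<le> ?S" if "\<nu> \<in> invariant_measures M" for \<nu>
    using that by (rule SUP_upper)
  \<comment> \<open>Any parameter above 1 would serve: one equilibrium state bounds the supremum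
    from below by its mean and from above through the pressure, so the supremum is real.\<close>
  have "ereal (A 2) \<le> ?S" using le_S[OF inv[of 2]] mean[of 2] by simp
  then obtain s where s: "?S = ereal s" using S_le[of 2] by (cases ?S) auto
  have upper: "A t \<le> s" if "1 < t" for t
    using le_S[OF inv[OF that]] mean[OF that] s by simp
  \<comment> \<open>The inequality \<open>t * s \<le> ?K + (t - 1) * A t\<close> solved for
    \<open>A t\<close>; it gives a rate of order \<open>1 / t\<close> for the convergence to the
    supremum.\<close>
  have lower: "s - (?K - s) / (t - 1) \<le> A t" if "1 < t" for t
  proof -
    have "t * s \<le> ?K + (t - 1) * A t" using S_le[OF that] that unfolding s by (simp add: field_simps)
    then show ?thesis using that by (simp add: field_simps)
  qed
  have A_lim: "(A \<longlongrightarrow> s) at_top"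
  proof (rule tendsto_sandwich)
    have "((\<lambda>t. s - c / (t - 1)) \<longlongrightarrow> s) at_top" for c :: real
      by real_asymp
    then show "((\<lambda>t. s - (?K - s) / (t - 1)) \<longlongrightarrow> s) at_top" .
    show "eventually (\<lambda>t. s - (?K - s) / (t - 1) \<le> A t) at_top" "eventually (\<lambda>t. A t \<le> s) at_top"
      using eventually_gt_at_top[of 1] by (eventually_elim, simp add: lower upper)+
  qed simp
  obtain \<tau> where \<mu>_inf: "\<mu>_inf \<in> invariant_measures M" and \<tau>: "\<And>k. 1 < \<tau> k" "filterlim \<tau> at_top sequentially"
    "weakly_converges M (\<lambda>k. \<mu> (\<tau> k)) \<mu>_inf"
    using assms(8) unfolding accumulation_point_at_top_def by blast
  \<comment> \<open>The means converge along the whole family, hence along the sequence defining the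
    accumulation point, and semicontinuity applies there.\<close>
  have "ereal s \<le> mean_potential f \<mu>_inf"
    using mean_potential_le_of_weak_limit[OF \<mu>_inf inv[OF \<tau>(1)] \<tau>(3) int[OF \<tau>(1)] mean[OF \<tau>(1)]]
      filterlim_compose[OF A_lim \<tau>(2)] by blast
  then have eq: "mean_potential f \<mu>_inf = ?S"
    using le_S[OF \<mu>_inf] by (simp add: s)
  have "((\<lambda>t. mean_potential f (\<mu> t)) \<longlongrightarrow> ereal s) at_top"
  proof (rule Lim_transform_eventually)
    show "((\<lambda>t. ereal (A t)) \<longlongrightarrow> ereal s) at_top" using A_lim by simp
    show "eventually (\<lambda>t. ereal (A t) = mean_potential f (\<mu> t)) at_top"
      using eventually_gt_at_top[of 1] by eventually_elim (simp add: mean)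
  qed
  then show ?thesis using \<mu>_inf eq by (simp add: maximising_measure_def s)
qed

end
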